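(* The graph $C_{17}(2,4,8)$ has no quantum symmetry, i.e. the $C^*$-algebra $A(C_{17}(2,4,8))$ is commutative.
   Context: $C_{17}(2,4,8)$ is the graph with vertex set $\mathbb{Z}/17\mathbb{Z}=\{0,1,\dots,16\}$ in which $i\sim j$ if and only if $i-j \bmod 17\in\{\pm1,\pm2,\pm4,\pm8\}$. A matrix $u=(u_{ij})$ with entries in a unital $C^*$-algebra is magic unitary if all its entries are projections, distinct entries in the same row or the same column are orthogonal, and each row and each column sums to $1$. $A_s(n)$ is the universal unital $C^*$-algebra generated by $n^2$ elements $u_{ij}$ subject to the relations making $u=(u_{ij})$ magic unitary. For a finite graph $X$ with $n$ vertices and adjacency matrix $d_X\in M_n(\{0,1\})$, $A(X)=A_s(n)/\langle d_Xu=ud_X\rangle$. $X$ has no quantum symmetry if $A(X)$ is commutative (equivalently $A(X)=C(\mathrm{Aut}(X))$). *)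

theory Defs
  imports Complex_Main "HOL-Algebra.QuotRing" "HOL-Algebra.Module"
    "HOL-Library.Poly_Mapping" "HOL-Library.Numeral_Type"
begin

section \<open>Unital C*-algebras\<close>

record 'a cstar_algebra = "(complex, 'a) module" +
  involution :: "'a \<Rightarrow> 'a"
  cnorm :: "'a \<Rightarrow> real"

definition cconverges :: "('a, 'b) cstar_algebra_scheme \<Rightarrow> (nat \<Rightarrow> 'a) \<Rightarrow> 'a \<Rightarrow> bool" where
  "cconverges A s x \<longleftrightarrow> (\<lambda>n. cnorm A (s n \<ominus>\<^bsub>A\<^esub> x)) \<longlonglongrightarrow> 0"

definition cCauchy :: "('a, 'b) cstar_algebra_scheme \<Rightarrow> (nat \<Rightarrow> 'a) \<Rightarrow> bool" where
  "cCauchy A s \<longleftrightarrow> (\<forall>e>0. \<exists>M. \<forall>m\<ge>M. \<forall>n\<ge>M. cnorm A (s m \<ominus>\<^bsub>A\<^esub> s n) < e)"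

locale unital_cstar_algebra = ring A for A :: "('a, 'b) cstar_algebra_scheme" (structure) +
  assumes smult_closed: "x \<in> carrier A \<Longrightarrow> c \<odot> x \<in> carrier A"
    and smult_l_distr: "x \<in> carrier A \<Longrightarrow> (c + d) \<odot> x = c \<odot> x \<oplus> d \<odot> x"
    and smult_r_distr: "x \<in> carrier A \<Longrightarrow> y \<in> carrier A \<Longrightarrow> c \<odot> (x \<oplus> y) = c \<odot> x \<oplus> c \<odot> y"
    and smult_assoc: "x \<in> carrier A \<Longrightarrow> (c * d) \<odot> x = c \<odot> (d \<odot> x)"
    and smult_one: "x \<in> carrier A \<Longrightarrow> 1 \<odot> x = x"
    and smult_mult_left: "x \<in> carrier A \<Longrightarrow> y \<in> carrier A \<Longrightarrow> (c \<odot> x) \<otimes> y = c \<odot> (x \<otimes> y)"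
    and smult_mult_right: "x \<in> carrier A \<Longrightarrow> y \<in> carrier A \<Longrightarrow> x \<otimes> (c \<odot> y) = c \<odot> (x \<otimes> y)"
    and star_closed: "x \<in> carrier A \<Longrightarrow> involution A x \<in> carrier A"
    and star_star: "x \<in> carrier A \<Longrightarrow> involution A (involution A x) = x"
    and star_add: "x \<in> carrier A \<Longrightarrow> y \<in> carrier A \<Longrightarrow>
          involution A (x \<oplus> y) = involution A x \<oplus> involution A y"
    and star_smult: "x \<in> carrier A \<Longrightarrow> involution A (c \<odot> x) = cnj c \<odot> involution A x"
    and star_mult: "x \<in> carrier A \<Longrightarrow> y \<in> carrier A \<Longrightarrow>
          involution A (x \<otimes> y) = involution A y \<otimes> involution A x"
    and norm_nonneg: "x \<in> carrier A \<Longrightarrow> 0 \<le> cnorm A x"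
    and norm_eq_zero: "x \<in> carrier A \<Longrightarrow> cnorm A x = 0 \<longleftrightarrow> x = \<zero>"
    and norm_triangle: "x \<in> carrier A \<Longrightarrow> y \<in> carrier A \<Longrightarrow> cnorm A (x \<oplus> y) \<le> cnorm A x + cnorm A y"
    and norm_smult: "x \<in> carrier A \<Longrightarrow> cnorm A (c \<odot> x) = cmod c * cnorm A x"
    and norm_mult: "x \<in> carrier A \<Longrightarrow> y \<in> carrier A \<Longrightarrow> cnorm A (x \<otimes> y) \<le> cnorm A x * cnorm A y"
    and cstar_identity: "x \<in> carrier A \<Longrightarrow> cnorm A (involution A x \<otimes> x) = (cnorm A x)\<^sup>2"
    and complete: "(\<And>n. s n \<in> carrier A) \<Longrightarrow> cCauchy A s \<Longrightarrow> \<exists>x\<in>carrier A. cconverges A s x"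

definition commutative_algebra :: "('a, 'b) cstar_algebra_scheme \<Rightarrow> bool" where
  "commutative_algebra A \<longleftrightarrow> (\<forall>x\<in>carrier A. \<forall>y\<in>carrier A. x \<otimes>\<^bsub>A\<^esub> y = y \<otimes>\<^bsub>A\<^esub> x)"

text \<open>
  Two-sided ideals of the underlying ring.  Being closed under scalars follows from the unit, and
  closed two-sided ideals of a C*-algebra are automatically self-adjoint.
\<close>

definition closed_ideal :: "('a, 'b) cstar_algebra_scheme \<Rightarrow> 'a set \<Rightarrow> bool" where
  "closed_ideal A I \<longleftrightarrow> ideal I A \<and>
     (\<forall>s x. (\<forall>n. s n \<in> I) \<and> x \<in> carrier A \<and> cconverges A s x \<longrightarrow> x \<in> I)"

definition gen_closed_ideal :: "('a, 'b) cstar_algebra_scheme \<Rightarrow> 'a set \<Rightarrow> 'a set" where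
  "gen_closed_ideal A S = \<Inter>{I. closed_ideal A I \<and> S \<subseteq> I}"

definition cstar_quotient :: "('a, 'b) cstar_algebra_scheme \<Rightarrow> 'a set \<Rightarrow> 'a set cstar_algebra" where
  "cstar_quotient A I =
    \<lparr>carrier = carrier (A Quot I), mult = mult (A Quot I), one = one (A Quot I),
     zero = zero (A Quot I), add = add (A Quot I),
     smult = (\<lambda>c X. \<Union>x\<in>X. I +>\<^bsub>A\<^esub> (c \<odot>\<^bsub>A\<^esub> x)),
     involution = (\<lambda>X. \<Union>x\<in>X. I +>\<^bsub>A\<^esub> involution A x),
     cnorm = (\<lambda>X. INF x\<in>X. cnorm A x)\<rparr>"


section \<open>The free unital *-algebra\<close>

text \<open>A letter \<open>(g, False)\<close> is the generator \<open>g\<close>, and \<open>(g, True)\<close> is its adjoint.\<close>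

datatype 'g star_word = Word (letters: "('g \<times> bool) list")

instantiation star_word :: (type) monoid_add
begin

definition zero_star_word :: "'a star_word" where
  "0 = Word []"

definition plus_star_word :: "'a star_word \<Rightarrow> 'a star_word \<Rightarrow> 'a star_word" where
  "v + w = Word (letters v @ letters w)"

instance
  by standard (auto simp: zero_star_word_def plus_star_word_def)

end

definition word_star :: "'g star_word \<Rightarrow> 'g star_word" where
  "word_star w = Word (rev (map (\<lambda>(g, b). (g, \<not> b)) (letters w)))"

lemma word_star_word_star [simp]: "word_star (word_star w) = w"
  by (cases w) (simp add: word_star_def rev_map case_prod_beta comp_def)

lemma word_star_add: "word_star (v + w) = word_star w + word_star v"
  by (simp add: word_star_def plus_star_word_def)

lemma word_star_zero [simp]: "word_star 0 = 0"
  by (simp add: word_star_def zero_star_word_def)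

lemma inj_word_star: "inj word_star"
  by (metis injI word_star_word_star)

text \<open>The monoid algebra of words; its ring structure is that of \<^theory>\<open>HOL-Library.Poly_Mapping\<close>.\<close>

type_synonym 'g free_star_algebra = "'g star_word \<Rightarrow>\<^sub>0 complex"

definition fgen :: "'g \<Rightarrow> 'g free_star_algebra" where
  "fgen g = Poly_Mapping.single (Word [(g, False)]) 1"

definition fscale :: "complex \<Rightarrow> 'g free_star_algebra \<Rightarrow> 'g free_star_algebra" where
  "fscale c a = Poly_Mapping.single 0 c * a"

lift_definition fstar :: "'g free_star_algebra \<Rightarrow> 'g free_star_algebra"
  is "\<lambda>a w. cnj (a (word_star w))"
proof -
  fix a :: "'g star_word \<Rightarrow> complex"
  assume "finite {w. a w \<noteq> 0}"
  then have "finite (word_star -` {w. a w \<noteq> 0})"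
    by (rule finite_vimageI) (rule inj_word_star)
  then show "finite {w. cnj (a (word_star w)) \<noteq> 0}"
    by (simp add: vimage_def)
qed

lemma fstar_single: "fstar (Poly_Mapping.single w c) = Poly_Mapping.single (word_star w) (cnj c)"
proof (rule poly_mapping_eqI)
  fix k
  have "w = word_star k \<longleftrightarrow> word_star w = k" by (metis word_star_word_star)
  then show "Poly_Mapping.lookup (fstar (Poly_Mapping.single w c)) k
      = Poly_Mapping.lookup (Poly_Mapping.single (word_star w) (cnj c)) k"
    by (simp add: fstar.rep_eq lookup_single when_def)
qed

lemma fstar_add: "fstar (a + b) = fstar a + fstar b"
  by (rule poly_mapping_eqI) (simp add: fstar.rep_eq lookup_add)

lemma fstar_diff: "fstar (a - b) = fstar a - fstar b"
  by (rule poly_mapping_eqI) (simp add: fstar.rep_eq lookup_minus)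

lemma fstar_fstar [simp]: "fstar (fstar a) = a"
  by (rule poly_mapping_eqI) (simp add: fstar.rep_eq)

lemma fstar_zero [simp]: "fstar 0 = 0"
  by (rule poly_mapping_eqI) (simp add: fstar.rep_eq)

lemma free_star_algebra_induct [case_names zero add_single]:
  assumes "P 0" "\<And>a w c. P a \<Longrightarrow> P (a + Poly_Mapping.single w c)"
  shows "P (a :: 'g free_star_algebra)"
proof (induction a rule: update_induct)
  case (update f w c)
  have "Poly_Mapping.update w c f = f + Poly_Mapping.single w c"
    using update(1)
    by (intro poly_mapping_eqI)
      (auto simp: lookup_update lookup_add lookup_single when_def in_keys_iff)
  then show ?case using assms(2)[OF update(3)] by simp
qed (rule assms)

lemma fstar_mult: "fstar (a * b) = fstar b * fstar a"
proof (induction a rule: free_star_algebra_induct)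
  case (add_single a w c)
  have "fstar (Poly_Mapping.single w c * b) = fstar b * fstar (Poly_Mapping.single w c)"
    by (induction b rule: free_star_algebra_induct)
      (auto simp: distrib_left distrib_right fstar_add mult_single fstar_single word_star_add mult.commute)
  with add_single show ?case by (simp add: distrib_left distrib_right fstar_add)
qed simp

lemma fscale_mult_left: "fscale c a * b = fscale c (a * b)"
  by (simp add: fscale_def mult.assoc)

lemma fscale_mult_right: "a * fscale c b = fscale c (a * b)"
proof -
  have "a * Poly_Mapping.single 0 c = Poly_Mapping.single 0 c * a"
    by (induction a rule: free_star_algebra_induct)
      (auto simp: distrib_left distrib_right mult_single mult.commute)
  then show ?thesis by (simp add: fscale_def flip: mult.assoc)
qed

lemma fscale_fscale: "fscale c (fscale d a) = fscale (c * d) a"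
  by (simp add: fscale_def mult_single flip: mult.assoc)

lemma fscale_one [simp]: "fscale 1 a = a"
  by (simp add: fscale_def)

lemma fscale_minus_one: "fscale (-1) a = - a"
  by (simp add: fscale_def single_uminus)

lemma fscale_add_left: "fscale (c + d) a = fscale c a + fscale d a"
  by (simp add: fscale_def single_add distrib_right)

lemma fscale_add_right: "fscale c (a + b) = fscale c a + fscale c b"
  by (simp add: fscale_def distrib_left)

lemma fscale_diff_right: "fscale c (a - b) = fscale c a - fscale c b"
  by (simp add: fscale_def right_diff_distrib)

lemma fstar_fscale: "fstar (fscale c a) = fscale (cnj c) (fstar a)"
proof -
  have "fstar (fscale c a) = fstar a * fscale (cnj c) 1"
    by (simp add: fscale_def fstar_mult fstar_single)
  also have "\<dots> = fscale (cnj c) (fstar a)"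
    by (simp add: fscale_mult_right)
  finally show ?thesis .
qed


section \<open>C*-seminorms\<close>

locale cstar_seminorm =
  fixes p :: "'g free_star_algebra \<Rightarrow> real"
  assumes nonneg: "0 \<le> p a"
    and triangle: "p (a + b) \<le> p a + p b"
    and scale: "p (fscale c a) = cmod c * p a"
    and submult: "p (a * b) \<le> p a * p b"
    and cstar: "p (fstar a * a) = (p a)\<^sup>2"
begin

lemma zero [simp]: "p 0 = 0"
  using scale[of 0 0] by (simp add: fscale_def)

lemma uminus [simp]: "p (- a) = p a"
  using scale[of "-1" a] by (simp add: fscale_minus_one)

lemma minus_commute: "p (a - b) = p (b - a)"
  using uminus[of "a - b"] by simp

lemma triangle_diff: "p (a - c) \<le> p (a - b) + p (b - c)"
  using triangle[of "a - b" "b - c"] by simp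

lemma diff_bound: "\<bar>p a - p b\<bar> \<le> p (a - b)"
  using triangle[of "a - b" b] triangle[of "b - a" a] minus_commute[of a b] by simp

lemma star_le: "p a \<le> p (fstar a)"
proof (cases "p a = 0")
  case False
  have "p a * p a \<le> p (fstar a) * p a"
    using submult[of "fstar a" a] cstar[of a] by (simp add: power2_eq_square)
  with False nonneg[of a] show ?thesis by simp
qed (simp add: nonneg)

lemma star [simp]: "p (fstar a) = p a"
  using star_le[of a] star_le[of "fstar a"] by simp

end


section \<open>The universal unital C*-algebra of generators and relations\<close>

text \<open>
  The unital C*-algebra generated by the \<open>g\<close>'s, universal for the relations \<open>r = 0\<close> (\<open>r \<in> R\<close>),
  is the separated completion of the free unital *-algebra with respect to the supremum of all
  C*-seminorms that vanish on \<open>R\<close>; these are the C*-seminorms of the quotient by the *-ideal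
  generated by \<open>R\<close>.  This is meaningful only if the supremum is finite
  (cf. \<open>magic_admissible\<close> below).
\<close>

definition admissible :: "'g free_star_algebra set \<Rightarrow> ('g free_star_algebra \<Rightarrow> real) set" where
  "admissible R = {q. cstar_seminorm q \<and> (\<forall>r\<in>R. q r = 0)}"

definition universal_seminorm :: "'g free_star_algebra set \<Rightarrow> 'g free_star_algebra \<Rightarrow> real" where
  "universal_seminorm R a = (SUP q\<in>admissible R. q a)"

text \<open>The supremum is a C*-seminorm as soon as it is finite.\<close>

lemma cstar_seminorm_0: "cstar_seminorm (\<lambda>_. 0)"
  by unfold_locales auto

lemma zero_admissible: "(\<lambda>_. 0) \<in> admissible R"
  by (simp add: admissible_def cstar_seminorm_0)

context
  fixes R :: "'g free_star_algebra set"
  assumes bdd: "\<And>a. bdd_above ((\<lambda>q. q a) ` admissible R)"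
begin

lemma universal_seminorm_upper: "q \<in> admissible R \<Longrightarrow> q a \<le> universal_seminorm R a"
  unfolding universal_seminorm_def by (rule cSUP_upper[OF _ bdd])

lemma universal_seminorm_least:
  "(\<And>q. q \<in> admissible R \<Longrightarrow> q a \<le> x) \<Longrightarrow> universal_seminorm R a \<le> x"
  unfolding universal_seminorm_def using zero_admissible by (intro cSUP_least) auto

lemma universal_seminorm_relation: "r \<in> R \<Longrightarrow> universal_seminorm R r = 0"
  using universal_seminorm_least[of r 0] universal_seminorm_upper[OF zero_admissible, of r]
  by (force simp: admissible_def)

lemma cstar_seminorm_universal: "cstar_seminorm (universal_seminorm R)"
proof
  let ?p = "universal_seminorm R"
  show nonneg: "0 \<le> ?p a" for a
    using universal_seminorm_upper[OF zero_admissible] .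
  show "?p (a + b) \<le> ?p a + ?p b" for a b
  proof (rule universal_seminorm_least)
    fix q assume q: "q \<in> admissible R"
    then have "q (a + b) \<le> q a + q b"
      by (simp add: admissible_def cstar_seminorm.triangle)
    then show "q (a + b) \<le> ?p a + ?p b"
      using universal_seminorm_upper[OF q, of a] universal_seminorm_upper[OF q, of b] by simp
  qed
  have scale_le: "?p (fscale c a) \<le> cmod c * ?p a" for c a
  proof (rule universal_seminorm_least)
    fix q assume q: "q \<in> admissible R"
    then show "q (fscale c a) \<le> cmod c * ?p a"
      using universal_seminorm_upper[OF q, of a]
      by (simp add: admissible_def cstar_seminorm.scale mult_left_mono)
  qed
  show "?p (fscale c a) = cmod c * ?p a" for c a
  proof (cases "c = 0")
    case True
    then show ?thesis using scale_le[of 0 a] nonneg[of "fscale 0 a"] by simp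
  next
    case False
    have "cmod c * ?p a = cmod c * ?p (fscale (inverse c) (fscale c a))"
      using False by (simp add: fscale_fscale)
    also have "\<dots> \<le> cmod c * (cmod (inverse c) * ?p (fscale c a))"
      by (intro mult_left_mono scale_le) simp
    also have "\<dots> = ?p (fscale c a)"
      using False by (simp add: norm_inverse)
    finally show ?thesis using scale_le[of c a] by simp
  qed
  show "?p (a * b) \<le> ?p a * ?p b" for a b
  proof (rule universal_seminorm_least)
    fix q assume q: "q \<in> admissible R"
    then interpret q: cstar_seminorm q by (simp add: admissible_def)
    have "q (a * b) \<le> q a * q b" by (rule q.submult)
    also have "\<dots> \<le> ?p a * ?p b"
      by (intro mult_mono universal_seminorm_upper q nonneg q.nonneg)
    finally show "q (a * b) \<le> ?p a * ?p b" .
  qed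
  show "?p (fstar a * a) = (?p a)\<^sup>2" for a
  proof (rule antisym)
    show "?p (fstar a * a) \<le> (?p a)\<^sup>2"
    proof (rule universal_seminorm_least)
      fix q assume q: "q \<in> admissible R"
      then interpret q: cstar_seminorm q by (simp add: admissible_def)
      show "q (fstar a * a) \<le> (?p a)\<^sup>2"
        using power_mono[OF universal_seminorm_upper[OF q] q.nonneg] by (simp add: q.cstar)
    qed
    have "?p a \<le> sqrt (?p (fstar a * a))"
    proof (rule universal_seminorm_least)
      fix q assume q: "q \<in> admissible R"
      then interpret q: cstar_seminorm q by (simp add: admissible_def)
      have "(q a)\<^sup>2 \<le> ?p (fstar a * a)"
        using universal_seminorm_upper[OF q, of "fstar a * a"] by (simp add: q.cstar)
      then show "q a \<le> sqrt (?p (fstar a * a))"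
        by (rule real_le_rsqrt)
    qed
    then show "(?p a)\<^sup>2 \<le> ?p (fstar a * a)"
      using power_mono[OF _ nonneg, of a "sqrt (?p (fstar a * a))" 2] nonneg by simp
  qed
qed

end

definition Cauchy_seqs :: "('g free_star_algebra \<Rightarrow> real) \<Rightarrow> (nat \<Rightarrow> 'g free_star_algebra) set" where
  "Cauchy_seqs p = {s. \<forall>e>0. \<exists>M. \<forall>m\<ge>M. \<forall>n\<ge>M. p (s m - s n) < e}"

definition null_rel ::
  "('g free_star_algebra \<Rightarrow> real) \<Rightarrow> ((nat \<Rightarrow> 'g free_star_algebra) \<times> (nat \<Rightarrow> 'g free_star_algebra)) set"
  where
  "null_rel p = {(s, t). s \<in> Cauchy_seqs p \<and> t \<in> Cauchy_seqs p \<and> (\<lambda>n. p (s n - t n)) \<longlonglongrightarrow> 0}"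

abbreviation seq_class ::
  "('g free_star_algebra \<Rightarrow> real) \<Rightarrow> (nat \<Rightarrow> 'g free_star_algebra) \<Rightarrow> (nat \<Rightarrow> 'g free_star_algebra) set"
  where
  "seq_class p s \<equiv> null_rel p `` {s}"

definition completion ::
  "('g free_star_algebra \<Rightarrow> real) \<Rightarrow> (nat \<Rightarrow> 'g free_star_algebra) set cstar_algebra" where
  "completion p =
    \<lparr>carrier = Cauchy_seqs p // null_rel p,
     mult = (\<lambda>X Y. \<Union>s\<in>X. \<Union>t\<in>Y. seq_class p (\<lambda>n. s n * t n)),
     one = seq_class p (\<lambda>n. 1),
     zero = seq_class p (\<lambda>n. 0),
     add = (\<lambda>X Y. \<Union>s\<in>X. \<Union>t\<in>Y. seq_class p (\<lambda>n. s n + t n)),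
     smult = (\<lambda>c X. \<Union>s\<in>X. seq_class p (\<lambda>n. fscale c (s n))),
     involution = (\<lambda>X. \<Union>s\<in>X. seq_class p (\<lambda>n. fstar (s n))),
     cnorm = (\<lambda>X. the_elem ((\<lambda>s. lim (\<lambda>n. p (s n))) ` X))\<rparr>"

context cstar_seminorm
begin

lemma Cauchy_const [simp]: "(\<lambda>n. a) \<in> Cauchy_seqs p"
  by (simp add: Cauchy_seqs_def)

lemma Cauchy_convergent: assumes "s \<in> Cauchy_seqs p" shows "convergent (\<lambda>n. p (s n))"
proof -
  have "Cauchy (\<lambda>n. p (s n))"
    unfolding Cauchy_def dist_real_def
    using assms unfolding Cauchy_seqs_def by (blast intro: le_less_trans[OF diff_bound])
  then show ?thesis by (simp add: Cauchy_convergent_iff)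
qed

lemma Cauchy_bounded: assumes "s \<in> Cauchy_seqs p" obtains K where "K > 0" "\<And>n. p (s n) \<le> K"
proof -
  have "Bseq (\<lambda>n. p (s n))"
    using Cauchy_convergent[OF assms] by (rule convergent_imp_Bseq)
  then show thesis by (auto simp: Bseq_def nonneg intro: that)
qed

lemma Cauchy_Lipschitz:
  assumes s: "s \<in> Cauchy_seqs p" and K: "K \<ge> 0" "\<And>m n. p (t m - t n) \<le> K * p (s m - s n)"
  shows "t \<in> Cauchy_seqs p"
  unfolding Cauchy_seqs_def
proof (intro CollectI allI impI)
  fix e :: real assume "e > 0"
  then have "e / (K + 1) > 0" using K by simp
  then obtain M where M: "\<And>m n. m \<ge> M \<Longrightarrow> n \<ge> M \<Longrightarrow> p (s m - s n) < e / (K + 1)"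
    using s by (fastforce simp: Cauchy_seqs_def)
  have "p (t m - t n) < e" if "m \<ge> M" "n \<ge> M" for m n
  proof -
    have "p (t m - t n) \<le> (K + 1) * p (s m - s n)"
      using K(2)[of m n] nonneg[of "s m - s n"] by (simp add: distrib_right)
    also have "\<dots> < e" using M[OF that] K(1) by (simp add: field_simps)
    finally show ?thesis .
  qed
  then show "\<exists>M. \<forall>m\<ge>M. \<forall>n\<ge>M. p (t m - t n) < e" by blast
qed

lemma Cauchy_Lipschitz2:
  assumes s: "s \<in> Cauchy_seqs p" "s' \<in> Cauchy_seqs p"
    and K: "K > 0" "\<And>m n. p (t m - t n) \<le> K * (p (s m - s n) + p (s' m - s' n))"
  shows "t \<in> Cauchy_seqs p"
  unfolding Cauchy_seqs_def
proof (intro CollectI allI impI)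
  fix e :: real assume "e > 0"
  then have e: "e / (2 * K) > 0" using K by simp
  obtain M where M: "\<And>m n. m \<ge> M \<Longrightarrow> n \<ge> M \<Longrightarrow> p (s m - s n) < e / (2 * K)"
    using s e by (fastforce simp: Cauchy_seqs_def)
  obtain M' where M': "\<And>m n. m \<ge> M' \<Longrightarrow> n \<ge> M' \<Longrightarrow> p (s' m - s' n) < e / (2 * K)"
    using s e by (fastforce simp: Cauchy_seqs_def)
  have "p (t m - t n) < e" if "m \<ge> max M M'" "n \<ge> max M M'" for m n
  proof -
    have "p (s m - s n) + p (s' m - s' n) < e / (2 * K) + e / (2 * K)"
      using M[of m n] M'[of m n] that by (intro add_strict_mono) auto
    also have "\<dots> = e / K" using K(1) by (simp add: field_simps)
    finally have "K * (p (s m - s n) + p (s' m - s' n)) < e"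
      using K(1) by (simp add: field_simps)
    with K(2)[of m n] show ?thesis by simp
  qed
  then show "\<exists>M. \<forall>m\<ge>M. \<forall>n\<ge>M. p (t m - t n) < e" by blast
qed

lemma add_diff_bound: "p ((a + b) - (c + d)) \<le> 1 * (p (a - c) + p (b - d))"
  using triangle[of "a - c" "b - d"] by (simp add: algebra_simps)

lemma mult_diff_bound:
  assumes "p b \<le> K" "p c \<le> K"
  shows "p (a * b - c * d) \<le> K * (p (a - c) + p (b - d))"
proof -
  have "p (a * b - c * d) \<le> p ((a - c) * b) + p (c * (b - d))"
    using triangle[of "(a - c) * b" "c * (b - d)"] by (simp add: algebra_simps)
  also have "\<dots> \<le> p (a - c) * p b + p c * p (b - d)"
    by (intro add_mono submult)
  also have "\<dots> \<le> p (a - c) * K + K * p (b - d)"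
    using assms nonneg by (intro add_mono mult_mono) (auto intro: order_trans[OF nonneg assms(1)])
  finally show ?thesis by (simp add: algebra_simps)
qed

lemma Cauchy_add: "s \<in> Cauchy_seqs p \<Longrightarrow> t \<in> Cauchy_seqs p \<Longrightarrow> (\<lambda>n. s n + t n) \<in> Cauchy_seqs p"
  by (rule Cauchy_Lipschitz2[where K = 1, OF _ _ _ add_diff_bound]) auto

lemma Cauchy_mult:
  assumes "s \<in> Cauchy_seqs p" "t \<in> Cauchy_seqs p"
  shows "(\<lambda>n. s n * t n) \<in> Cauchy_seqs p"
proof -
  obtain K L where "K > 0" "\<And>n. p (s n) \<le> K" "L > 0" "\<And>n. p (t n) \<le> L"
    using Cauchy_bounded assms by metis
  then show ?thesis
    by (intro Cauchy_Lipschitz2[where K = "max K L", OF assms _ mult_diff_bound]) (auto simp: le_max_iff_disj)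
qed

lemma Cauchy_scale: "s \<in> Cauchy_seqs p \<Longrightarrow> (\<lambda>n. fscale c (s n)) \<in> Cauchy_seqs p"
  by (rule Cauchy_Lipschitz[where K = "cmod c"]) (auto simp: scale simp flip: fscale_diff_right)

lemma Cauchy_star: "s \<in> Cauchy_seqs p \<Longrightarrow> (\<lambda>n. fstar (s n)) \<in> Cauchy_seqs p"
  by (rule Cauchy_Lipschitz[where K = 1]) (auto simp flip: fstar_diff)

lemma Cauchy_uminus: "s \<in> Cauchy_seqs p \<Longrightarrow> (\<lambda>n. - s n) \<in> Cauchy_seqs p"
  using Cauchy_scale[of s "-1"] by (simp add: fscale_minus_one)

lemma null_rel_le:
  assumes "s \<in> Cauchy_seqs p" "t \<in> Cauchy_seqs p" "f \<longlonglongrightarrow> 0" "\<And>n. p (s n - t n) \<le> f n"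
  shows "(s, t) \<in> null_rel p"
  using tendsto_sandwich[OF _ _ tendsto_const assms(3), of "\<lambda>n. p (s n - t n)"] assms
  by (auto simp: null_rel_def nonneg)

lemma equiv_null_rel: "equiv (Cauchy_seqs p) (null_rel p)"
proof (rule equivI)
  show "null_rel p \<subseteq> Cauchy_seqs p \<times> Cauchy_seqs p" by (auto simp: null_rel_def)
  show "refl_on (Cauchy_seqs p) (null_rel p)"
    by (auto simp: refl_on_def null_rel_def)
  show "sym (null_rel p)"
    by (auto simp: sym_def null_rel_def minus_commute)
  show "trans (null_rel p)"
  proof (rule transI)
    fix s t u assume st: "(s, t) \<in> null_rel p" and tu: "(t, u) \<in> null_rel p"
    show "(s, u) \<in> null_rel p"
    proof (rule null_rel_le)
      show "(\<lambda>n. p (s n - t n) + p (t n - u n)) \<longlonglongrightarrow> 0"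
        using st tu by (auto simp: null_rel_def intro!: tendsto_add_zero)
    qed (use st tu in \<open>auto simp: null_rel_def triangle_diff\<close>)
  qed
qed

lemma null_rel_iff_zero:
  "s \<in> Cauchy_seqs p \<Longrightarrow> t \<in> Cauchy_seqs p \<Longrightarrow>
     (s, t) \<in> null_rel p \<longleftrightarrow> (\<lambda>n. p (s n - t n)) \<longlonglongrightarrow> 0"
  by (simp add: null_rel_def)

lemma seq_class_eq_iff:
  "s \<in> Cauchy_seqs p \<Longrightarrow> t \<in> Cauchy_seqs p \<Longrightarrow>
     seq_class p s = seq_class p t \<longleftrightarrow> (\<lambda>n. p (s n - t n)) \<longlonglongrightarrow> 0"
  using eq_equiv_class_iff[OF equiv_null_rel] by (simp add: null_rel_iff_zero)

lemma seq_classI: "s \<in> Cauchy_seqs p \<Longrightarrow> seq_class p s \<in> carrier (completion p)"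
  by (simp add: completion_def quotientI)

lemma carrierE:
  assumes "X \<in> carrier (completion p)"
  obtains s where "s \<in> Cauchy_seqs p" "X = seq_class p s"
  using assms by (auto simp: completion_def elim: quotientE)

lemma respects2_op:
  assumes "\<And>s t. s \<in> Cauchy_seqs p \<Longrightarrow> t \<in> Cauchy_seqs p \<Longrightarrow> (\<lambda>n. f (s n) (t n)) \<in> Cauchy_seqs p"
    and "\<And>s t s' t'. (s, s') \<in> null_rel p \<Longrightarrow> (t, t') \<in> null_rel p \<Longrightarrow>
        \<exists>K. \<forall>n. p (f (s n) (t n) - f (s' n) (t' n)) \<le> K * (p (s n - s' n) + p (t n - t' n))"
  shows "(\<lambda>s t. seq_class p (\<lambda>n. f (s n) (t n))) respects2 null_rel p"
proof (rule congruent2I')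
  fix s s' t t' assume st: "(s, s') \<in> null_rel p" "(t, t') \<in> null_rel p"
  obtain K where K: "\<And>n. p (f (s n) (t n) - f (s' n) (t' n)) \<le> K * (p (s n - s' n) + p (t n - t' n))"
    using assms(2)[OF st] by blast
  show "seq_class p (\<lambda>n. f (s n) (t n)) = seq_class p (\<lambda>n. f (s' n) (t' n))"
  proof (rule equiv_class_eq[OF equiv_null_rel], rule null_rel_le[OF _ _ _ K])
    show "(\<lambda>n. K * (p (s n - s' n) + p (t n - t' n))) \<longlonglongrightarrow> 0"
      using st by (auto simp: null_rel_def intro!: tendsto_mult_right_zero tendsto_add_zero)
  qed (use st assms(1) in \<open>auto simp: null_rel_def\<close>)
qed

lemma completion_add:
  assumes "s \<in> Cauchy_seqs p" "t \<in> Cauchy_seqs p"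
  shows "seq_class p s \<oplus>\<^bsub>completion p\<^esub> seq_class p t = seq_class p (\<lambda>n. s n + t n)"
proof -
  have "(\<lambda>s t. seq_class p (\<lambda>n. s n + t n)) respects2 null_rel p"
    by (intro respects2_op Cauchy_add) (use add_diff_bound in blast)+
  from UN_equiv_class2[OF equiv_null_rel equiv_null_rel this assms] show ?thesis
    by (simp add: completion_def)
qed

lemma completion_mult:
  assumes "s \<in> Cauchy_seqs p" "t \<in> Cauchy_seqs p"
  shows "seq_class p s \<otimes>\<^bsub>completion p\<^esub> seq_class p t = seq_class p (\<lambda>n. s n * t n)"
proof -
  have "(\<lambda>s t. seq_class p (\<lambda>n. s n * t n)) respects2 null_rel p"
  proof (intro respects2_op Cauchy_mult)
    fix s t s' t' assume "(s, s') \<in> null_rel p" "(t, t') \<in> null_rel p"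
    then have "s' \<in> Cauchy_seqs p" "t \<in> Cauchy_seqs p" by (auto simp: null_rel_def)
    then obtain K L where "\<And>n. p (s' n) \<le> K" "\<And>n. p (t n) \<le> L"
      using Cauchy_bounded by metis
    then show "\<exists>K. \<forall>n. p (s n * t n - s' n * t' n) \<le> K * (p (s n - s' n) + p (t n - t' n))"
      by (intro exI[of _ "max K L"] allI mult_diff_bound) (auto simp: le_max_iff_disj)
  qed
  from UN_equiv_class2[OF equiv_null_rel equiv_null_rel this assms] show ?thesis
    by (simp add: completion_def)
qed

lemma completion_smult:
  assumes "s \<in> Cauchy_seqs p"
  shows "c \<odot>\<^bsub>completion p\<^esub> seq_class p s = seq_class p (\<lambda>n. fscale c (s n))"
proof -
  have "(\<lambda>s. seq_class p (\<lambda>n. fscale c (s n))) respects null_rel p"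
  proof (rule congruentI)
    fix s t assume "(s, t) \<in> null_rel p"
    then have st: "s \<in> Cauchy_seqs p" "t \<in> Cauchy_seqs p" "(\<lambda>n. p (s n - t n)) \<longlonglongrightarrow> 0"
      by (auto simp: null_rel_def)
    show "seq_class p (\<lambda>n. fscale c (s n)) = seq_class p (\<lambda>n. fscale c (t n))"
      unfolding seq_class_eq_iff[OF st(1,2)[THEN Cauchy_scale]]
      using tendsto_mult_right_zero[OF st(3)] by (simp add: scale flip: fscale_diff_right)
  qed
  from UN_equiv_class[OF equiv_null_rel this assms] show ?thesis
    by (simp add: completion_def)
qed

lemma completion_star:
  assumes "s \<in> Cauchy_seqs p"
  shows "involution (completion p) (seq_class p s) = seq_class p (\<lambda>n. fstar (s n))"
proof -
  have "(\<lambda>s. seq_class p (\<lambda>n. fstar (s n))) respects null_rel p"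
  proof (rule congruentI)
    fix s t assume "(s, t) \<in> null_rel p"
    then have st: "s \<in> Cauchy_seqs p" "t \<in> Cauchy_seqs p" "(\<lambda>n. p (s n - t n)) \<longlonglongrightarrow> 0"
      by (auto simp: null_rel_def)
    show "seq_class p (\<lambda>n. fstar (s n)) = seq_class p (\<lambda>n. fstar (t n))"
      unfolding seq_class_eq_iff[OF st(1,2)[THEN Cauchy_star]]
      using st(3) by (simp flip: fstar_diff)
  qed
  from UN_equiv_class[OF equiv_null_rel this assms] show ?thesis
    by (simp add: completion_def)
qed

lemma completion_norm:
  assumes s: "s \<in> Cauchy_seqs p"
  shows "cnorm (completion p) (seq_class p s) = lim (\<lambda>n. p (s n))"
proof -
  have eq: "lim (\<lambda>n. p (t n)) = lim (\<lambda>n. p (s n))" if "(s, t) \<in> null_rel p" for t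
  proof (rule limI)
    have d: "(\<lambda>n. p (s n - t n)) \<longlonglongrightarrow> 0" using that by (simp add: null_rel_def)
    have "(\<lambda>n. p (t n) - p (s n)) \<longlonglongrightarrow> 0"
      by (rule tendsto_rabs_zero_cancel, rule tendsto_sandwich[OF _ _ tendsto_const d])
        (use diff_bound in \<open>auto simp: minus_commute abs_minus_commute\<close>)
    from tendsto_add[OF this convergent_LIMSEQ_iff[THEN iffD1, OF Cauchy_convergent[OF s]]]
    show "(\<lambda>n. p (t n)) \<longlonglongrightarrow> lim (\<lambda>n. p (s n))" by simp
  qed
  have "(\<lambda>s. lim (\<lambda>n. p (s n))) ` seq_class p s = (\<lambda>_. lim (\<lambda>n. p (s n))) ` seq_class p s"
    by (rule image_cong[OF refl], rule eq) simp
  also have "\<dots> = {lim (\<lambda>n. p (s n))}"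
    by (rule image_constant[OF equiv_class_self[OF equiv_null_rel s]])
  finally have "(\<lambda>s. lim (\<lambda>n. p (s n))) ` seq_class p s = {lim (\<lambda>n. p (s n))}" .
  then show ?thesis by (simp add: completion_def)
qed

lemma completion_norm_LIMSEQ:
  assumes "s \<in> Cauchy_seqs p"
  shows "(\<lambda>n. p (s n)) \<longlonglongrightarrow> cnorm (completion p) (seq_class p s)"
  using Cauchy_convergent[OF assms] assms by (simp add: completion_norm convergent_LIMSEQ_iff)

lemma completion_one: "\<one>\<^bsub>completion p\<^esub> = seq_class p (\<lambda>n. 1)"
  and completion_zero: "\<zero>\<^bsub>completion p\<^esub> = seq_class p (\<lambda>n. 0)"
  by (simp_all add: completion_def)

lemmas completion_ops = completion_add completion_mult completion_smult completion_star
  completion_one completion_zero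

lemmas Cauchy_ops = Cauchy_add Cauchy_mult Cauchy_scale Cauchy_star Cauchy_uminus

lemma ring_completion: "ring (completion p)"
proof (rule ringI)
  show "abelian_group (completion p)"
  proof (rule abelian_groupI)
    fix X assume "X \<in> carrier (completion p)"
    then obtain s where s: "s \<in> Cauchy_seqs p" "X = seq_class p s" by (rule carrierE)
    show "\<exists>Y\<in>carrier (completion p). Y \<oplus>\<^bsub>completion p\<^esub> X = \<zero>\<^bsub>completion p\<^esub>"
      by (rule bexI[of _ "seq_class p (\<lambda>n. - s n)"])
        (simp_all add: s completion_ops Cauchy_ops seq_classI)
  qed (auto elim!: carrierE simp: completion_ops Cauchy_ops seq_classI algebra_simps)
  show "Group.monoid (completion p)"
    by (rule monoidI)
      (auto elim!: carrierE simp: completion_ops Cauchy_ops seq_classI algebra_simps)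
qed (auto elim!: carrierE simp: completion_ops Cauchy_ops seq_classI algebra_simps)

lemma completion_uminus:
  assumes "s \<in> Cauchy_seqs p"
  shows "\<ominus>\<^bsub>completion p\<^esub> seq_class p s = seq_class p (\<lambda>n. - s n)"
proof -
  interpret ring "completion p" by (rule ring_completion)
  show ?thesis
    by (rule minus_equality) (use assms in \<open>simp_all add: completion_ops Cauchy_ops seq_classI\<close>)
qed

lemma completion_minus:
  assumes "s \<in> Cauchy_seqs p" "t \<in> Cauchy_seqs p"
  shows "seq_class p s \<ominus>\<^bsub>completion p\<^esub> seq_class p t = seq_class p (\<lambda>n. s n - t n)"
  using assms by (simp add: a_minus_def completion_uminus completion_ops Cauchy_ops)

lemma Cauchy_diff: "s \<in> Cauchy_seqs p \<Longrightarrow> t \<in> Cauchy_seqs p \<Longrightarrow> (\<lambda>n. s n - t n) \<in> Cauchy_seqs p"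
  using Cauchy_add[OF _ Cauchy_uminus] by simp

lemma complete_completion:
  assumes X: "\<And>k. X k \<in> carrier (completion p)" and C: "cCauchy (completion p) X"
  shows "\<exists>Y\<in>carrier (completion p). cconverges (completion p) X Y"
proof -
  let ?N = "cnorm (completion p)"
  have "\<forall>k. \<exists>s. s \<in> Cauchy_seqs p \<and> X k = seq_class p s" using X by (meson carrierE)
  then obtain S where S: "\<And>k. S k \<in> Cauchy_seqs p" "\<And>k. X k = seq_class p (S k)" by metis
  have "\<forall>k. \<exists>M. \<forall>m\<ge>M. p (S k m - S k M) < inverse (real (Suc k))"
  proof
    fix k
    obtain M where "\<forall>m\<ge>M. \<forall>n\<ge>M. p (S k m - S k n) < inverse (real (Suc k))"
      using S(1)[of k] unfolding Cauchy_seqs_def by (fastforce simp del: of_nat_Suc)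
    then show "\<exists>M. \<forall>m\<ge>M. p (S k m - S k M) < inverse (real (Suc k))" by blast
  qed
  then obtain M where M: "\<And>k m. m \<ge> M k \<Longrightarrow> p (S k m - S k (M k)) < inverse (real (Suc k))" by metis
  define t where "t k = S k (M k)" for k
  have approx: "?N (X k \<ominus>\<^bsub>completion p\<^esub> seq_class p (\<lambda>n. t k)) \<le> inverse (real (Suc k))" for k
  proof -
    have "X k \<ominus>\<^bsub>completion p\<^esub> seq_class p (\<lambda>n. t k) = seq_class p (\<lambda>n. S k n - t k)"
      using S[of k] by (simp add: completion_minus)
    moreover have "(\<lambda>n. p (S k n - t k)) \<longlonglongrightarrow> ?N (seq_class p (\<lambda>n. S k n - t k))"
      using S(1) by (intro completion_norm_LIMSEQ Cauchy_diff) auto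
    ultimately show ?thesis
      using M[of k] by (intro LIMSEQ_le_const2) (auto simp: t_def intro!: exI[of _ "M k"] less_imp_le)
  qed
  have N_minus: "?N (seq_class p s \<ominus>\<^bsub>completion p\<^esub> seq_class p u) \<le>
      ?N (seq_class p s \<ominus>\<^bsub>completion p\<^esub> seq_class p v) + ?N (seq_class p v \<ominus>\<^bsub>completion p\<^esub> seq_class p u)"
    if "s \<in> Cauchy_seqs p" "u \<in> Cauchy_seqs p" "v \<in> Cauchy_seqs p" for s u v
    using that
    by (simp add: completion_minus)
      (intro LIMSEQ_le[OF completion_norm_LIMSEQ tendsto_add[OF completion_norm_LIMSEQ completion_norm_LIMSEQ]]
        exI allI impI triangle_diff Cauchy_diff; assumption)
  have N_sym: "?N (seq_class p s \<ominus>\<^bsub>completion p\<^esub> seq_class p u) = ?N (seq_class p u \<ominus>\<^bsub>completion p\<^esub> seq_class p s)"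
    if "s \<in> Cauchy_seqs p" "u \<in> Cauchy_seqs p" for s u
    using that by (simp add: completion_minus completion_norm Cauchy_diff) (metis minus_commute)
  have N_const: "?N (seq_class p (\<lambda>n. a) \<ominus>\<^bsub>completion p\<^esub> seq_class p (\<lambda>n. b)) = p (a - b)" for a b
    by (simp add: completion_minus completion_norm)
  have t_Cauchy: "t \<in> Cauchy_seqs p"
    unfolding Cauchy_seqs_def
  proof (intro CollectI allI impI)
    fix e :: real assume e: "e > 0"
    obtain K where K: "\<And>m n. m \<ge> K \<Longrightarrow> n \<ge> K \<Longrightarrow> ?N (X m \<ominus>\<^bsub>completion p\<^esub> X n) < e / 3"
      using C e unfolding cCauchy_def by (metis divide_pos_pos zero_less_numeral)
    obtain L where L: "inverse (real (Suc L)) < e / 3"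
      using reals_Archimedean[of "e / 3"] e by auto
    have "p (t m - t n) < e" if mn: "m \<ge> max K L" "n \<ge> max K L" for m n
    proof -
      have inv: "inverse (real (Suc k)) < e / 3" if "k \<ge> L" for k
        using L that by (smt (verit) Suc_le_mono inverse_le_iff_le of_nat_0_less_iff of_nat_le_iff zero_less_Suc)
      have "p (t m - t n) \<le> ?N (seq_class p (\<lambda>_. t m) \<ominus>\<^bsub>completion p\<^esub> X m)
          + (?N (X m \<ominus>\<^bsub>completion p\<^esub> X n) + ?N (X n \<ominus>\<^bsub>completion p\<^esub> seq_class p (\<lambda>_. t n)))"
        using N_minus[of "\<lambda>_. t m" "\<lambda>_. t n" "S m"] N_minus[of "S m" "\<lambda>_. t n" "S n"] S
        by (simp add: N_const)
      moreover have "?N (seq_class p (\<lambda>_. t m) \<ominus>\<^bsub>completion p\<^esub> X m) < e / 3"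
        using approx[of m] inv[of m] mn N_sym[of "\<lambda>_. t m" "S m"] S by simp
      moreover have "?N (X n \<ominus>\<^bsub>completion p\<^esub> seq_class p (\<lambda>_. t n)) < e / 3"
        using approx[of n] inv[of n] mn by simp
      ultimately show ?thesis using K[of m n] mn by simp
    qed
    then show "\<exists>M. \<forall>m\<ge>M. \<forall>n\<ge>M. p (t m - t n) < e" by blast
  qed
  have lim_t: "(\<lambda>k. ?N (seq_class p (\<lambda>_. t k) \<ominus>\<^bsub>completion p\<^esub> seq_class p t)) \<longlonglongrightarrow> 0"
  proof (rule LIMSEQ_I)
    fix e :: real assume e: "e > 0"
    obtain K where K: "\<And>m n. m \<ge> K \<Longrightarrow> n \<ge> K \<Longrightarrow> p (t m - t n) < e / 2"
    proof -
      have "e / 2 > 0" using e by simp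
      with t_Cauchy show thesis unfolding Cauchy_seqs_def using that by blast
    qed
    have "norm (?N (seq_class p (\<lambda>_. t k) \<ominus>\<^bsub>completion p\<^esub> seq_class p t) - 0) < e" if "k \<ge> K" for k
    proof -
      have l: "(\<lambda>n. p (t k - t n)) \<longlonglongrightarrow> ?N (seq_class p (\<lambda>n. t k - t n))"
        by (intro completion_norm_LIMSEQ Cauchy_diff t_Cauchy) simp
      have "?N (seq_class p (\<lambda>n. t k - t n)) \<le> e / 2"
        using K that by (intro LIMSEQ_le_const2[OF l]) (auto intro!: exI[of _ K] less_imp_le)
      moreover have "?N (seq_class p (\<lambda>n. t k - t n)) \<ge> 0"
        by (intro LIMSEQ_le_const[OF l]) (auto simp: nonneg)
      ultimately show ?thesis using e t_Cauchy by (simp add: completion_minus)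
    qed
    then show "\<exists>K. \<forall>k\<ge>K. norm (?N (seq_class p (\<lambda>_. t k) \<ominus>\<^bsub>completion p\<^esub> seq_class p t) - 0) < e"
      by blast
  qed
  have "(\<lambda>k. ?N (X k \<ominus>\<^bsub>completion p\<^esub> seq_class p t)) \<longlonglongrightarrow> 0"
  proof (rule tendsto_sandwich[OF _ _ tendsto_const])
    show "(\<lambda>k. inverse (real (Suc k)) + ?N (seq_class p (\<lambda>_. t k) \<ominus>\<^bsub>completion p\<^esub> seq_class p t)) \<longlonglongrightarrow> 0"
      using tendsto_add[OF LIMSEQ_inverse_real_of_nat lim_t] by simp
    show "\<forall>\<^sub>F k in sequentially. ?N (X k \<ominus>\<^bsub>completion p\<^esub> seq_class p t)
        \<le> inverse (real (Suc k)) + ?N (seq_class p (\<lambda>_. t k) \<ominus>\<^bsub>completion p\<^esub> seq_class p t)"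
    proof (rule always_eventually, rule allI)
      fix k
      show "?N (X k \<ominus>\<^bsub>completion p\<^esub> seq_class p t)
          \<le> inverse (real (Suc k)) + ?N (seq_class p (\<lambda>_. t k) \<ominus>\<^bsub>completion p\<^esub> seq_class p t)"
        using N_minus[OF S(1)[of k] t_Cauchy Cauchy_const[of "t k"]] approx[of k] S(2)[of k] by simp
    qed
    show "\<forall>\<^sub>F k in sequentially. 0 \<le> ?N (X k \<ominus>\<^bsub>completion p\<^esub> seq_class p t)"
    proof (rule always_eventually, rule allI)
      fix k
      have "(\<lambda>n. p (S k n - t n)) \<longlonglongrightarrow> ?N (seq_class p (\<lambda>n. S k n - t n))"
        by (intro completion_norm_LIMSEQ Cauchy_diff t_Cauchy S)
      then have "0 \<le> ?N (seq_class p (\<lambda>n. S k n - t n))"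
        by (rule LIMSEQ_le_const) (auto simp: nonneg)
      then show "0 \<le> ?N (X k \<ominus>\<^bsub>completion p\<^esub> seq_class p t)"
        by (simp add: S completion_minus t_Cauchy)
    qed
  qed
  then show ?thesis
    using t_Cauchy by (auto simp: cconverges_def intro: seq_classI)
qed

theorem unital_cstar_algebra_completion: "unital_cstar_algebra (completion p)"
proof (intro unital_cstar_algebra.intro ring_completion unital_cstar_algebra_axioms.intro)
  fix X Y and c
  assume "X \<in> carrier (completion p)" "Y \<in> carrier (completion p)"
  then obtain s t where s: "s \<in> Cauchy_seqs p" "X = seq_class p s"
    and t: "t \<in> Cauchy_seqs p" "Y = seq_class p t" by (meson carrierE)
  note lims = completion_norm_LIMSEQ[OF s(1)] completion_norm_LIMSEQ[OF t(1)]
  show "cnorm (completion p) (X \<oplus>\<^bsub>completion p\<^esub> Y) \<le> cnorm (completion p) X + cnorm (completion p) Y"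
    unfolding s t completion_add[OF s(1) t(1)]
    by (intro LIMSEQ_le[OF completion_norm_LIMSEQ[OF Cauchy_add[OF s(1) t(1)]] tendsto_add[OF lims]]
        exI allI impI triangle)
  show "cnorm (completion p) (X \<otimes>\<^bsub>completion p\<^esub> Y) \<le> cnorm (completion p) X * cnorm (completion p) Y"
    unfolding s t completion_mult[OF s(1) t(1)]
    by (intro LIMSEQ_le[OF completion_norm_LIMSEQ[OF Cauchy_mult[OF s(1) t(1)]] tendsto_mult[OF lims]]
        exI allI impI submult)
next
  fix X and c
  assume "X \<in> carrier (completion p)"
  then obtain s where s: "s \<in> Cauchy_seqs p" "X = seq_class p s" by (rule carrierE)
  note l = completion_norm_LIMSEQ[OF s(1)]
  show "0 \<le> cnorm (completion p) X"
    unfolding s by (rule LIMSEQ_le_const[OF l]) (auto simp: nonneg)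
  show "cnorm (completion p) X = 0 \<longleftrightarrow> X = \<zero>\<^bsub>completion p\<^esub>"
    unfolding s completion_zero using l LIMSEQ_unique[OF l, of 0]
    by (auto simp: seq_class_eq_iff[OF s(1) Cauchy_const])
  show "cnorm (completion p) (c \<odot>\<^bsub>completion p\<^esub> X) = cmod c * cnorm (completion p) X"
    unfolding s completion_smult[OF s(1)]
    using LIMSEQ_unique[OF completion_norm_LIMSEQ[OF Cauchy_scale[OF s(1)]]] tendsto_mult_left[OF l]
    by (simp add: scale)
  show "cnorm (completion p) (involution (completion p) X \<otimes>\<^bsub>completion p\<^esub> X) = (cnorm (completion p) X)\<^sup>2"
    unfolding s completion_star[OF s(1)] completion_mult[OF Cauchy_star[OF s(1)] s(1)]
    using LIMSEQ_unique[OF completion_norm_LIMSEQ[OF Cauchy_mult[OF Cauchy_star[OF s(1)] s(1)]]] tendsto_power[OF l]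
    by (simp add: cstar)
qed (auto elim!: carrierE simp: completion_ops Cauchy_ops seq_classI complete_completion
      fscale_add_left fscale_add_right fscale_fscale fscale_mult_left fscale_mult_right
      fstar_add fstar_fscale fstar_mult)

end

definition universal_cstar_algebra ::
  "'g free_star_algebra set \<Rightarrow> (nat \<Rightarrow> 'g free_star_algebra) set cstar_algebra" where
  "universal_cstar_algebra R = completion (universal_seminorm R)"

definition universal_gen ::
  "'g free_star_algebra set \<Rightarrow> 'g \<Rightarrow> (nat \<Rightarrow> 'g free_star_algebra) set" where
  "universal_gen R g = seq_class (universal_seminorm R) (\<lambda>n. fgen g)"


section \<open>Quantum permutation algebras\<close>

definition cprojection :: "('a, 'b) cstar_algebra_scheme \<Rightarrow> 'a \<Rightarrow> bool" where
  "cprojection A x \<longleftrightarrow> x \<in> carrier A \<and> x \<otimes>\<^bsub>A\<^esub> x = x \<and> involution A x = x"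

definition magic_unitary :: "('a, 'b) cstar_algebra_scheme \<Rightarrow> ('v::finite \<Rightarrow> 'v \<Rightarrow> 'a) \<Rightarrow> bool" where
  "magic_unitary A u \<longleftrightarrow>
     (\<forall>i j. cprojection A (u i j)) \<and>
     (\<forall>i j k. j \<noteq> k \<longrightarrow> u i j \<otimes>\<^bsub>A\<^esub> u i k = \<zero>\<^bsub>A\<^esub>) \<and>
     (\<forall>i j k. i \<noteq> k \<longrightarrow> u i j \<otimes>\<^bsub>A\<^esub> u k j = \<zero>\<^bsub>A\<^esub>) \<and>
     (\<forall>i. (\<Oplus>\<^bsub>A\<^esub>j\<in>UNIV. u i j) = \<one>\<^bsub>A\<^esub>) \<and>
     (\<forall>j. (\<Oplus>\<^bsub>A\<^esub>i\<in>UNIV. u i j) = \<one>\<^bsub>A\<^esub>)"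

text \<open>The same conditions as relations in the free unital *-algebra on generators \<open>(i, j)\<close>.\<close>

definition magic_relations :: "('v::finite \<times> 'v) free_star_algebra set" where
  "magic_relations =
     {fgen (i, j) * fgen (i, j) - fgen (i, j) | i j. True} \<union>
     {fstar (fgen (i, j)) - fgen (i, j) | i j. True} \<union>
     {fgen (i, j) * fgen (i, k) | i j k. j \<noteq> k} \<union>
     {fgen (i, j) * fgen (k, j) | i j k. i \<noteq> k} \<union>
     {(\<Sum>j\<in>UNIV. fgen (i, j)) - 1 | i. True} \<union>
     {(\<Sum>i\<in>UNIV. fgen (i, j)) - 1 | j. True}"

text \<open>For the magic relations the supremum is finite, since generators have norm at most 1.\<close>

lemma magic_gen_bound:
  assumes q: "q \<in> admissible magic_relations"
  shows "q (fgen (i, j)) \<le> 1"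
proof -
  interpret cstar_seminorm q using q by (simp add: admissible_def)
  let ?u = "fgen (i, j) :: ('a \<times> 'a) free_star_algebra"
  have rel: "q r = 0" if "r \<in> magic_relations" for r
    using q that by (simp add: admissible_def)
  have 1: "q (?u * ?u - ?u) = 0"
    by (rule rel) (auto simp: magic_relations_def)
  have "q (fstar ?u - ?u) = 0"
    by (rule rel) (auto simp: magic_relations_def)
  then have "q ((fstar ?u - ?u) * ?u) = 0"
    using submult[of "fstar ?u - ?u" ?u] nonneg[of "(fstar ?u - ?u) * ?u"] by simp
  then have "q (fstar ?u * ?u - ?u) = 0"
    using triangle[of "(fstar ?u - ?u) * ?u" "?u * ?u - ?u"] 1 nonneg[of "fstar ?u * ?u - ?u"]
    by (simp add: left_diff_distrib)
  then have "(q ?u)\<^sup>2 = q ?u"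
    using diff_bound[of "fstar ?u * ?u" ?u] by (simp add: cstar)
  then show ?thesis by (auto simp: power2_eq_square)
qed

lemma magic_word_bound:
  assumes q: "q \<in> admissible magic_relations"
  shows "q (Poly_Mapping.single (Word w) c) \<le> cmod c"
proof -
  interpret cstar_seminorm q using q by (simp add: admissible_def)
  have letter: "q (Poly_Mapping.single (Word [x]) 1) \<le> 1" for x :: "('a \<times> 'a) \<times> bool"
  proof -
    obtain i j b where x: "x = ((i, j), b)" by (metis surj_pair)
    have "fstar (fgen (i, j)) = Poly_Mapping.single (Word [((i, j), True)]) 1"
      by (simp add: fgen_def fstar_single word_star_def)
    then show ?thesis
      using magic_gen_bound[OF q, of i j] star[of "fgen (i, j)"]
      by (cases b) (simp_all add: x fgen_def)
  qed
  have one: "q 1 \<le> 1"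
  proof -
    have "fstar 1 = (1 :: ('a \<times> 'a) free_star_algebra)"
      using fstar_single[of 0 1] by simp
    then have "(q 1)\<^sup>2 = q 1" using cstar[of 1] by simp
    then show ?thesis by (auto simp: power2_eq_square)
  qed
  have "q (Poly_Mapping.single (Word w) 1) \<le> 1"
  proof (induction w)
    case Nil
    then show ?case using one by (simp flip: zero_star_word_def)
  next
    case (Cons x w)
    have "Poly_Mapping.single (Word (x # w)) 1
        = Poly_Mapping.single (Word [x]) (1::complex) * Poly_Mapping.single (Word w) 1"
      by (simp add: mult_single plus_star_word_def)
    then have "q (Poly_Mapping.single (Word (x # w)) 1)
        \<le> q (Poly_Mapping.single (Word [x]) 1) * q (Poly_Mapping.single (Word w) 1)"
      using submult by metis
    also have "\<dots> \<le> 1" using Cons letter[of x] by (intro mult_le_one nonneg) auto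
    finally show ?case .
  qed
  then have "cmod c * q (Poly_Mapping.single (Word w) 1) \<le> cmod c * 1"
    by (rule mult_left_mono) simp
  moreover have "Poly_Mapping.single (Word w) c = fscale c (Poly_Mapping.single (Word w) 1)"
    by (simp add: fscale_def mult_single)
  ultimately show ?thesis by (simp add: scale)
qed

lemma magic_admissible: "bdd_above ((\<lambda>q. q a) ` admissible magic_relations)"
proof (induction a rule: free_star_algebra_induct)
  case zero
  then show ?case by (auto simp: bdd_above_def admissible_def cstar_seminorm.zero intro!: exI[of _ 0])
next
  case (add_single a w c)
  then obtain K where K: "\<And>q. q \<in> admissible magic_relations \<Longrightarrow> q a \<le> K"
    by (auto simp: bdd_above_def)
  have "q (a + Poly_Mapping.single w c) \<le> K + cmod c" if q: "q \<in> admissible magic_relations" for q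
    using cstar_seminorm.triangle[of q a "Poly_Mapping.single w c"] K[OF q]
      magic_word_bound[OF q, of "letters w" c] q
    by (simp add: admissible_def)
  then show ?case by (auto simp: bdd_above_def)
qed

lemma cstar_seminorm_magic: "cstar_seminorm (universal_seminorm magic_relations)"
  by (rule cstar_seminorm_universal[OF magic_admissible])

type_synonym 'v qperm_elem = "(nat \<Rightarrow> ('v \<times> 'v) free_star_algebra) set"

text \<open>\<open>A\<^sub>s(n)\<close>, with \<open>n = CARD('v)\<close> and rows and columns indexed by \<open>'v\<close>.\<close>

definition quantum_perm_algebra :: "'v::finite qperm_elem cstar_algebra" where
  "quantum_perm_algebra = universal_cstar_algebra magic_relations"

definition qperm_gen :: "'v::finite \<Rightarrow> 'v \<Rightarrow> 'v qperm_elem" where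
  "qperm_gen i j = universal_gen magic_relations (i, j)"

lemma unital_cstar_algebra_quantum_perm_algebra: "unital_cstar_algebra quantum_perm_algebra"
  unfolding quantum_perm_algebra_def universal_cstar_algebra_def
  by (rule cstar_seminorm.unital_cstar_algebra_completion[OF cstar_seminorm_magic])

lemma magic_unitary_qperm_gen: "magic_unitary quantum_perm_algebra qperm_gen"
proof -
  let ?p = "universal_seminorm (magic_relations :: ('a \<times> 'a) free_star_algebra set)"
  interpret cstar_seminorm ?p by (rule cstar_seminorm_magic)
  let ?A = "completion ?p"
  let ?k = "\<lambda>a. seq_class ?p (\<lambda>n. a)"
  interpret A: ring ?A by (rule ring_completion)
  have const_eq: "?k a = ?k b" if "a - b \<in> magic_relations" for a b
    using universal_seminorm_relation[OF magic_admissible that] by (simp add: seq_class_eq_iff)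
  have const_sum: "(\<Oplus>\<^bsub>?A\<^esub>i\<in>S. ?k (f i)) = ?k (\<Sum>i\<in>S. f i)" if "finite S" for f and S :: "'a set"
    using that
    by (induction S rule: finite_induct) (simp_all add: completion_ops seq_classI Pi_iff)
  show ?thesis
    unfolding magic_unitary_def cprojection_def quantum_perm_algebra_def universal_cstar_algebra_def
      qperm_gen_def universal_gen_def
    by (auto simp: completion_ops seq_classI const_sum intro!: const_eq)
      (auto simp: magic_relations_def)
qed

definition finite_simple_graph :: "('v::finite \<Rightarrow> 'v \<Rightarrow> bool) \<Rightarrow> bool" where
  "finite_simple_graph X \<longleftrightarrow> symp X \<and> irreflp X"

definition adjacency_matrix :: "('v::finite \<Rightarrow> 'v \<Rightarrow> bool) \<Rightarrow> 'v \<Rightarrow> 'v \<Rightarrow> complex" where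
  "adjacency_matrix X i j = (if X i j then 1 else 0)"

text \<open>The relation \<open>d u = u d\<close> stands for its entries \<open>(d u - u d)\<^sub>i\<^sub>j = 0\<close>.\<close>

definition commutation_relations :: "('v::finite \<Rightarrow> 'v \<Rightarrow> complex) \<Rightarrow> 'v qperm_elem set" where
  "commutation_relations d = (let A = quantum_perm_algebra in
     {(\<Oplus>\<^bsub>A\<^esub>k\<in>UNIV. d i k \<odot>\<^bsub>A\<^esub> qperm_gen k j) \<ominus>\<^bsub>A\<^esub>
      (\<Oplus>\<^bsub>A\<^esub>k\<in>UNIV. d k j \<odot>\<^bsub>A\<^esub> qperm_gen i k) | i j. True})"

definition quantum_automorphism_algebra ::
  "('v::finite \<Rightarrow> 'v \<Rightarrow> bool) \<Rightarrow> 'v qperm_elem set cstar_algebra" where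
  "quantum_automorphism_algebra X =
     cstar_quotient quantum_perm_algebra
       (gen_closed_ideal quantum_perm_algebra (commutation_relations (adjacency_matrix X)))"

definition no_quantum_symmetry :: "('v::finite \<Rightarrow> 'v \<Rightarrow> bool) \<Rightarrow> bool" where
  "no_quantum_symmetry X \<longleftrightarrow> commutative_algebra (quantum_automorphism_algebra X)"

text \<open>The type \<open>17\<close> is the ring of integers modulo 17.\<close>

definition C17_2_4_8 :: "17 \<Rightarrow> 17 \<Rightarrow> bool" where
  "C17_2_4_8 i j \<longleftrightarrow> i - j \<in> {1, -1, 2, -2, 4, -4, 8, -8}"

lemma finite_simple_graph_C17_2_4_8: "finite_simple_graph C17_2_4_8"
proof -
  have "i - j \<in> {1, -1, 2, -2, 4, -4, 8, -8} \<Longrightarrow> j - i \<in> {1, -1, 2, -2, 4, -4, 8, -8}" for i j :: 17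
    using minus_diff_eq[of i j] by fastforce
  moreover have "(0::17) \<notin> {1, -1, 2, -2, 4, -4, 8, -8}" by simp
  ultimately show ?thesis
    unfolding finite_simple_graph_def symp_def irreflp_def C17_2_4_8_def by simp
qed

end

theory Submission
  imports Defs
begin

text \<open>
  The connection set \<open>{\<plusminus>1, \<plusminus>2, \<plusminus>4, \<plusminus>8}\<close> is the group of nonzero squares modulo 17, so the graph is the
  Paley graph on 17 vertices.  Classically its automorphisms are the maps \<open>x \<mapsto> a x + b\<close> with \<open>a\<close> a
  square, and composition with such a map turns the \<open>i\<close>-th character of \<open>\<int>/17\<close> into a multiple of the
  \<open>a i\<close>-th one.  The proof shows that quantum automorphisms have to follow this pattern.

  Let \<open>u\<close> be the fundamental magic unitary and pass to its two-sided Fourier transform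
  \<open>w\<^sub>i\<^sub>j = (1/17) \<Sum>\<^sub>k\<^sub>l \<zeta>\<^bsup>il - jk\<^esup> u\<^sub>k\<^sub>l\<close>, with \<open>\<zeta>\<close> a primitive 17th root of unity.  The magic relations
  say that \<open>w\<close> turns addition of indices into convolution, separately in the rows and in the columns
  (\<open>fourier_row\<close>, \<open>fourier_col\<close>).  The relation \<open>d u = u d\<close> says that \<open>w\<close> respects the eigenspaces of
  \<open>d\<close>; since the Gauss sums of squares and of nonsquares differ, \<open>w\<^sub>i\<^sub>j = 0\<close> whenever exactly one of
  \<open>i, j\<close> is a nonzero square (\<open>fourier_support\<close>).  No analysis is left in this reformulation: it is a
  system of quadratic relations with coefficients 0 and 1, sparse because a number is the sum of two
  nonzero squares in very few ways.

  In the classical picture \<open>w\<^sub>1\<^sub>a\<close> is supported on the automorphisms with multiplier \<open>a\<close>, which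
  suggests proving \<open>w\<^sub>1\<^sub>a w\<^sub>1\<^sub>b = 0\<close> for \<open>a \<noteq> b\<close>.  Rescaling columns by a square reduces this to
  \<open>a = 1\<close>.  Products \<open>w\<^sub>1\<^sub>1 w\<^sub>r\<^sub>s\<close> with \<open>r, s\<close> different squares are then shown to vanish in three
  steps, by expanding entries into products of two and regrouping: first when one of \<open>1 + r\<close>, \<open>1 + s\<close>
  is a nonzero square and the other a nonsquare (\<open>mixed_left\<close>, \<open>mixed_right\<close>), then when \<open>r\<close> and \<open>s\<close> have
  different numbers of decompositions of a certain kind (\<open>counting\<close>, \<open>separated\<close>), and finally when
  \<open>r = 1\<close> (\<open>row_one_orthogonal\<close>).  Row 1 of \<open>w\<close> thus consists of commuting elements; by the convolution
  rule it generates all other rows, and \<open>u\<close> is recovered from \<open>w\<close> by Fourier inversion.  Hence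
  the entries of \<open>u\<close> commute (\<open>entries_commute\<close>).

  It remains to connect this ring computation to the C*-algebra.  The noncommutative polynomials in
  the generators, modulo those that lie in the closed ideal defining the quotient, form a ring to which
  the computation applies.  Since polynomials are dense and the ideal is closed, all commutators of
  the quantum permutation algebra lie in the ideal (\<open>no_quantum_symmetry_criterion\<close>).
\<close>

section \<open>Squares modulo 17\<close>

text \<open>The nonzero squares modulo 17, which are also the connection set of the graph.\<close>

definition QR :: "17 set" where "QR = {1, 2, 4, 8, 9, 13, 15, 16}"

lemma all_17: "(\<forall>x::17. P x) \<longleftrightarrow> P 0 \<and> P 1 \<and> P 2 \<and> P 3 \<and> P 4 \<and> P 5 \<and> P 6 \<and> P 7 \<and> P 8 \<and>
    P 9 \<and> P 10 \<and> P 11 \<and> P 12 \<and> P 13 \<and> P 14 \<and> P 15 \<and> P 16"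
proof (intro iffI allI)
  fix x :: 17
  assume "P 0 \<and> P 1 \<and> P 2 \<and> P 3 \<and> P 4 \<and> P 5 \<and> P 6 \<and> P 7 \<and> P 8 \<and> P 9 \<and> P 10 \<and> P 11 \<and> P 12 \<and>
    P 13 \<and> P 14 \<and> P 15 \<and> P 16"
  moreover obtain z :: int where z: "x = of_int z" "0 \<le> z" "z < 17"
    by (cases x) auto
  moreover have "z \<in> {0, 1, 2, 3, 4, 5, 6, 7, 8, 9, 10, 11, 12, 13, 14, 15, 16}"
    using z(2,3) by simp presburger
  ultimately show "P x" by auto
qed simp

text \<open>Simplification decides equality of numerals modulo 17 but leaves the numerals that come out
  of sums and differences unreduced; these equations bring them to their representatives.\<close>

lemma reduce_17:
  "(17::17) = 0" "(18::17) = 1" "(19::17) = 2" "(20::17) = 3" "(21::17) = 4" "(22::17) = 5"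
  "(23::17) = 6" "(24::17) = 7" "(25::17) = 8" "(26::17) = 9" "(27::17) = 10" "(28::17) = 11"
  "(29::17) = 12" "(30::17) = 13" "(31::17) = 14" "(32::17) = 15"
  "(-1::17) = 16" "(-2::17) = 15" "(-3::17) = 14" "(-4::17) = 13" "(-5::17) = 12" "(-6::17) = 11"
  "(-7::17) = 10" "(-8::17) = 9" "(-9::17) = 8" "(-10::17) = 7" "(-11::17) = 6" "(-12::17) = 5"
  "(-13::17) = 4" "(-14::17) = 3" "(-15::17) = 2" "(-16::17) = 1"
  by simp_all

lemma QR_mult: "a \<in> QR \<Longrightarrow> b \<in> QR \<Longrightarrow> a * b \<in> QR"
  unfolding QR_def by (elim insertE emptyE) simp_all

lemma QR_inverse: "v \<in> QR \<Longrightarrow> \<exists>v'\<in>QR. v' * v = 1"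
  unfolding QR_def by (elim insertE emptyE) simp_all

text \<open>The decompositions of \<open>s\<close> into two nonzero squares, given by the first summand.\<close>

definition splits :: "17 \<Rightarrow> 17 set" where "splits s = {a. a \<in> QR \<and> s - a \<in> QR}"

text \<open>Summands in \<open>{1, 8, 15}\<close>, which play a special part below, come first.\<close>

lemma splits_values:
  "splits 1 = {2, 9, 16}" "splits 2 = {1, 15, 4}" "splits 4 = {8, 2, 13}"
  "splits 9 = {1, 8, 13}" "splits 13 = {15, 4, 9}" "splits 16 = {1, 8, 15}"
  by (simp_all add: set_eq_iff all_17 splits_def QR_def reduce_17)

section \<open>The quadratic relations between the Fourier coefficients\<close>

text \<open>
  A matrix \<open>w\<close> as in this locale describes an action on the group algebra of \<open>\<int>/17\<close>: the character
  \<open>X\<^sup>i\<close> is sent to \<open>\<Sum>\<^sub>a X\<^sup>a \<otimes> w\<^sub>i\<^sub>a\<close>.  Then \<open>row\<close> states multiplicativity, \<open>col\<close> is the same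
  condition for the transposed matrix, and \<open>supp\<close> says that the span of the characters \<open>X\<^sup>i\<close> with
  \<open>i\<close> a nonzero square is preserved.
\<close>

locale paley_coaction =
  fixes w :: "17 \<Rightarrow> 17 \<Rightarrow> 'r::ring"
  assumes supp: "(i \<in> QR) \<noteq> (a \<in> QR) \<Longrightarrow> w i a = 0"
    and row: "(\<Sum>a\<in>UNIV. w i a * w j (s - a)) = w (i + j) s"
    and col: "(\<Sum>i\<in>UNIV. w i a * w (t - i) b) = w t (a + b)"
begin

lemma coaction_transposed: "paley_coaction (\<lambda>i a. w a i)"
  by unfold_locales (auto simp: row col intro: supp)

lemma coaction_scaled:
  assumes v: "v \<in> QR"
  shows "paley_coaction (\<lambda>i a. w i (v * a))"
proof -
  obtain v' where v': "v' \<in> QR" "v' * v = 1"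
    using QR_inverse[OF v] by blast
  have mem: "v * a \<in> QR \<longleftrightarrow> a \<in> QR" for a
    using QR_mult[OF v, of a] QR_mult[OF v'(1), of "v * a"] v'(2) by (auto simp flip: mult.assoc)
  have bij: "bij ((*) v)"
    by (rule o_bij[of "(*) v'"]) (auto simp: fun_eq_iff v'(2) mult.assoc[symmetric] mult.commute[of v v'])
  show ?thesis
  proof
    show "(i \<in> QR) \<noteq> (a \<in> QR) \<Longrightarrow> w i (v * a) = 0" for i a
      by (rule supp) (simp add: mem)
    show "(\<Sum>a\<in>UNIV. w i (v * a) * w j (v * (s - a))) = w (i + j) (v * s)" for i j s
      using sum.reindex_bij_betw[OF bij, of "\<lambda>a. w i a * w j (v * s - a)"] row[of i j "v * s"]
      by (simp add: right_diff_distrib)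
    show "(\<Sum>i\<in>UNIV. w i (v * a) * w (t - i) (v * b)) = w t (v * (a + b))" for t a b
      using col[of "v * a" t "v * b"] by (simp add: distrib_left)
  qed
qed

lemma supp_nonzero: "w i a \<noteq> 0 \<Longrightarrow> i \<in> QR \<longleftrightarrow> a \<in> QR"
  using supp by blast

lemma row_splits:
  assumes "i \<in> QR" "j \<in> QR"
  shows "(\<Sum>a\<in>splits s. w i a * w j (s - a)) = w (i + j) s"
  unfolding row[symmetric]
  by (rule sum.mono_neutral_left) (use assms in \<open>auto simp: splits_def dest!: mult_not_zero supp_nonzero\<close>)

lemma col_splits:
  assumes "a \<in> QR" "b \<in> QR"
  shows "(\<Sum>i\<in>splits t. w i a * w (t - i) b) = w t (a + b)"
  unfolding col[symmetric]
  by (rule sum.mono_neutral_left) (use assms in \<open>auto simp: splits_def dest!: mult_not_zero supp_nonzero\<close>)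

text \<open>
  The basic source of vanishing products.  Expand \<open>w (m, a + b)\<close> over the rows \<open>i\<close> and sum over squares \<open>b\<close>
  first: the inner sum is \<open>w (m - i + r, c)\<close>, which is zero because \<open>c\<close> is a nonzero square and
  \<open>m - i + r\<close> is not.  For nonzero squares \<open>m\<close> and \<open>r\<close>, only those \<open>b\<close> survive in the conclusion for
  which \<open>a + b\<close> and \<open>c - b\<close> are nonzero squares as well, so it has very few terms.
\<close>

lemma exchange:
  assumes r: "\<And>j. j \<in> splits m \<Longrightarrow> j + r \<notin> QR" and a: "a \<in> QR" and c: "c \<in> QR"
  shows "(\<Sum>b\<in>QR. w m (a + b) * w r (c - b)) = 0"
proof -
  have inner: "w i a * (\<Sum>b\<in>QR. w (m - i) b * w r (c - b)) = 0" for i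
  proof (cases "i \<in> splits m")
    case True
    then have j: "m - i \<in> splits m" by (simp add: splits_def)
    then have "(\<Sum>b\<in>QR. w (m - i) b * w r (c - b)) = (\<Sum>b\<in>UNIV. w (m - i) b * w r (c - b))"
      by (intro sum.mono_neutral_left) (auto simp: splits_def supp)
    also have "\<dots> = 0" using r[OF j] c by (simp add: row supp)
    finally show ?thesis by simp
  next
    case False
    then show ?thesis using a by (cases "i \<in> QR") (auto simp: splits_def supp)
  qed
  have "(\<Sum>b\<in>QR. w m (a + b) * w r (c - b)) = (\<Sum>b\<in>QR. \<Sum>i\<in>UNIV. w i a * (w (m - i) b * w r (c - b)))"
    by (simp add: col[symmetric] sum_distrib_right mult.assoc)
  also have "\<dots> = (\<Sum>i\<in>UNIV. w i a * (\<Sum>b\<in>QR. w (m - i) b * w r (c - b)))"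
    by (subst sum.swap) (simp add: sum_distrib_left)
  finally show ?thesis by (simp add: inner)
qed

text \<open>
  The set \<open>{1, 8, 15}\<close> consists of the squares \<open>r\<close> for which \<open>1 + r\<close> is a nonzero square, and
  \<open>{2, 4, 9, 13}\<close> of those for which it is a nonsquare; for the remaining square 16 it is 0.  The
  hypothesis of \<open>exchange\<close> holds for \<open>m = 1\<close> and exactly the first kind of \<open>r\<close>.  With
  \<open>a + c = 1 + s\<close> and a suitable \<open>a\<close>, the only term not zero for reasons of support is
  \<open>w\<^sub>1\<^sub>1 w\<^sub>r\<^sub>s\<close>, or there is one more, which another choice of \<open>a\<close> shows to be zero.
\<close>

lemma mixed_left:
  assumes r: "r \<in> {1, 8, 15}" and s: "s \<in> {2, 4, 9, 13}"
  shows "w 1 1 * w r s = 0"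
proof -
  have rQ: "r \<in> QR" using r by (auto simp: QR_def)
  have "j + r \<notin> QR" if "j \<in> splits 1" for j
    using that r by (auto simp: splits_values QR_def reduce_17)
  note ex = exchange[of 1 r, OF this]
  have zero1: "w 1 x = 0" if "x \<notin> QR" for x
    using that by (intro supp) (simp add: QR_def)
  have zeror: "w r x = 0" if "x \<notin> QR" for x
    using that rQ by (intro supp) simp
  have "w 1 1 * w r 2 = 0"
    using ex[of 16 4] by (simp add: QR_def zero1 zeror reduce_17)
  moreover have "w 1 1 * w r 9 = 0"
    using ex[of 2 8] by (simp add: QR_def zero1 zeror reduce_17)
  moreover have "w 1 1 * w r 4 = 0"
    using ex[of 9 13] ex[of 4 1] by (simp add: QR_def zero1 zeror reduce_17)
  moreover have "w 1 1 * w r 13 = 0"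
    using ex[of 16 15] ex[of 13 1] by (simp add: QR_def zero1 zeror) (simp add: zero1 zeror QR_def reduce_17)
  ultimately show ?thesis using s by auto
qed

lemma mixed_right:
  assumes "r \<in> {2, 4, 9, 13}" "s \<in> {1, 8, 15}"
  shows "w 1 1 * w r s = 0"
  using paley_coaction.mixed_left[OF coaction_transposed assms(2,1)] .

text \<open>
  Consider the products of \<open>w\<^sub>1\<^sub>1\<close>, \<open>w (i, a)\<close> and \<open>w (r - i, s - a)\<close> for \<open>i\<close> and \<open>a\<close> in \<open>{1, 8, 15}\<close> that occur in
  splittings of \<open>r\<close> and \<open>s\<close>.  As the mixed products vanish, each row sum and each column sum of this
  array equals \<open>w\<^sub>1\<^sub>1 w\<^sub>r\<^sub>s\<close>.  With two rows and one column the total is both once and twice this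
  element, which is therefore zero.
\<close>

lemma counting:
  assumes Dr: "splits r = {i, i', i''}" "distinct [i, i', i'']" "i \<in> {1, 8, 15}" "i' \<in> {1, 8, 15}" "i'' \<in> {2, 4, 9, 13}"
    and Ds: "splits s = {a, a', a''}" "distinct [a, a', a'']" "a \<in> {1, 8, 15}" "a' \<in> {2, 4, 9, 13}" "a'' \<in> {2, 4, 9, 13}"
  shows "w 1 1 * w r s = 0"
proof -
  let ?y = "\<lambda>i. w 1 1 * (w i a * w (r - i) (s - a))"
  have z: "w 1 1 * (w i j * x) = 0" if "w 1 1 * w i j = 0" for i j x
    using that by (simp flip: mult.assoc)
  \<comment> \<open>The sum over row \<open>j\<close>: the entries at \<open>a'\<close> and \<open>a''\<close> are mixed products.\<close>
  have y: "?y j = w 1 1 * w r s" if "j \<in> {i, i'}" for j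
  proof -
    have j: "j \<in> splits r" "j \<in> {1, 8, 15}" using that Dr by auto
    then have "w 1 1 * w r s = w 1 1 * (\<Sum>b\<in>splits s. w j b * w (r - j) (s - b))"
      by (subst row_splits) (auto simp: splits_def)
    also have "\<dots> = ?y j"
      using Ds z[OF mixed_left[OF j(2) Ds(4)]] z[OF mixed_left[OF j(2) Ds(5)]] by (simp add: distrib_left)
    finally show ?thesis by simp
  qed
  \<comment> \<open>The sum over column \<open>a\<close>: the entry at \<open>i''\<close> is a mixed product.\<close>
  have "w 1 1 * w r s = ?y i + ?y i'"
  proof -
    have "a \<in> splits s" using Ds by simp
    then have "w 1 1 * w r s = w 1 1 * (\<Sum>j\<in>splits r. w j a * w (r - j) (s - a))"
      by (subst col_splits) (auto simp: splits_def)
    also have "\<dots> = ?y i + ?y i'"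
      using Dr z[OF mixed_right[OF Dr(5) Ds(3)]] by (simp add: distrib_left)
    finally show ?thesis .
  qed
  also have "\<dots> = w 1 1 * w r s + w 1 1 * w r s"
    by (simp only: y insertI1 insertI2)
  finally show ?thesis by (simp only: add_cancel_right_right)
qed

text \<open>
  The number of splittings with first summand in \<open>{1, 8, 15}\<close> is 2 for 2 and 9, it is 1 for 4 and 13, and
  it is 3 for 16.  For \<open>r = 16\<close> there is no summand in \<open>{2, 4, 9, 13}\<close> at all, so that choosing a
  column from this set makes every term a mixed product.
\<close>

lemma separated:
  assumes "r \<in> {2, 9, 16}" "s \<in> {4, 13}"
  shows "w 1 1 * w r s = 0"
proof -
  have z: "w 1 1 * (w i j * x) = 0" if "w 1 1 * w i j = 0" for i j x
    using that by (simp flip: mult.assoc)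
  have "w 1 1 * w 16 4 = w 1 1 * (\<Sum>i\<in>splits 16. w i 2 * w (16 - i) 2)"
    by (subst col_splits) (simp_all add: QR_def)
  then have "w 1 1 * w 16 4 = 0" by (simp add: splits_values distrib_left z mixed_left)
  moreover have "w 1 1 * w 16 13 = w 1 1 * (\<Sum>i\<in>splits 16. w i 4 * w (16 - i) 9)"
    by (subst col_splits) (simp_all add: QR_def)
  then have "w 1 1 * w 16 13 = 0" by (simp add: splits_values distrib_left z mixed_left)
  moreover have "w 1 1 * w 2 4 = 0" by (rule counting[OF splits_values(2) _ _ _ _ splits_values(3)]) simp_all
  moreover have "w 1 1 * w 2 13 = 0" by (rule counting[OF splits_values(2) _ _ _ _ splits_values(5)]) simp_all
  moreover have "w 1 1 * w 9 4 = 0" by (rule counting[OF splits_values(4) _ _ _ _ splits_values(3)]) simp_all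
  moreover have "w 1 1 * w 9 13 = 0" by (rule counting[OF splits_values(4) _ _ _ _ splits_values(5)]) simp_all
  ultimately show ?thesis using assms by auto
qed

text \<open>
  The cases \<open>s\<close> in \<open>{2, 4, 9, 13}\<close> are mixed products.  In the others, \<open>w\<^sub>1\<^sub>s\<close> is expanded so that its
  product with \<open>w\<^sub>1\<^sub>1\<close> has only terms known to vanish: as 1 splits with summands 2, 9 and 16, the
  columns 4 and 13 lead to \<open>separated\<close>; and as all summands of 16 lie in \<open>{1, 8, 15}\<close>, row 2 leads to
  mixed products.
\<close>

lemma row_one_orthogonal:
  assumes "s \<in> QR" "s \<noteq> 1"
  shows "w 1 1 * w 1 s = 0"
proof -
  have z: "w 1 1 * (w i j * x) = 0" if "w 1 1 * w i j = 0" for i j x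
    using that by (simp flip: mult.assoc)
  have "w 1 1 * w 1 8 = w 1 1 * (\<Sum>i\<in>splits 1. w i 4 * w (1 - i) 4)"
    by (subst col_splits) (simp_all add: QR_def)
  then have 8: "w 1 1 * w 1 8 = 0" by (simp add: splits_values distrib_left z separated)
  have "w 1 1 * w 1 15 = w 1 1 * (\<Sum>i\<in>splits 1. w i 13 * w (1 - i) 2)"
    by (subst col_splits) (simp_all add: QR_def)
  then have 15: "w 1 1 * w 1 15 = 0" by (simp add: splits_values distrib_left z separated)
  have "w 1 1 * w 1 16 = w 1 1 * (\<Sum>a\<in>splits 16. w 2 a * w 16 (16 - a))"
    by (subst row_splits) (simp_all add: QR_def reduce_17)
  then have 16: "w 1 1 * w 1 16 = 0" by (simp add: splits_values distrib_left z mixed_right)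
  have "s \<in> {2, 4, 9, 13} \<or> s = 8 \<or> s = 15 \<or> s = 16"
    using assms by (auto simp: QR_def)
  then show ?thesis using 8 15 16 mixed_left[of 1 s] by (elim disjE) simp_all
qed

lemma orthogonal:
  assumes "a \<noteq> b"
  shows "w 1 a * w 1 b = 0"
proof (cases "a \<in> QR \<and> b \<in> QR")
  case True
  then obtain a' where a': "a' \<in> QR" "a' * a = 1"
    using QR_inverse by blast
  then have "a' * b \<in> QR" "a * (a' * b) = b"
    using True by (auto intro: QR_mult simp flip: mult.assoc simp: mult.commute[of a a'])
  moreover from this(2) have "a' * b \<noteq> 1"
    using assms by auto
  ultimately obtain s where "s \<in> QR" "s \<noteq> 1" "a * s = b" by blast
  then show ?thesis
    using paley_coaction.row_one_orthogonal[OF coaction_scaled, of a s] True by simp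
next
  case False
  then show ?thesis by (auto simp: supp QR_def)
qed

text \<open>Orthogonal elements commute, and the row relation with \<open>j = 1\<close> expresses each row through the
  previous one and row 1, so commutation spreads from row 1 to all of \<open>w\<close>.\<close>

theorem commute: "w i a * w j b = w j b * w i a"
proof -
  have step: "x * w (i + 1) s = w (i + 1) s * x"
    if "\<And>a. x * w i a = w i a * x" "\<And>a. x * w 1 a = w 1 a * x" for x i s
  proof -
    have "x * (w i a * w 1 b) = (w i a * w 1 b) * x" for a b
      by (simp only: mult.assoc[symmetric] that(1)) (simp only: mult.assoc that(2))
    then show ?thesis
      unfolding row[of i 1 s, symmetric] by (simp add: sum_distrib_left sum_distrib_right)
  qed
  have gen: "x * w i a = w i a * x" if x: "\<And>a. x * w 1 a = w 1 a * x" for x i a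
  proof -
    \<comment> \<open>The induction starts at row 1, and reaches row 0 as row 17.\<close>
    have "\<forall>a. x * w (of_nat (Suc n)) a = w (of_nat (Suc n)) a * x" for n
    proof (induction n)
      case (Suc n)
      then show ?case using step[of x "of_nat (Suc n)"] x by (simp add: add.commute)
    qed (simp add: x)
    moreover obtain n where "i = of_nat (Suc n)"
    proof -
      obtain z :: int where z: "i = of_int z" "0 \<le> z" by (cases i) auto
      then have "of_nat (Suc (nat z + 16)) = i + 17"
        by (simp add: add.commute)
      then show thesis using that[of "nat z + 16"] by (simp add: reduce_17)
    qed
    ultimately show ?thesis by simp
  qed
  have "w 1 a * w 1 b = w 1 b * w 1 a" for a b
    by (cases "a = b") (simp_all add: orthogonal)
  then have "w 1 b * w i a = w i a * w 1 b" for i a b by (rule gen)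
  then have "w i a * w 1 b = w 1 b * w i a" for i a b by (rule sym)
  then show ?thesis by (rule gen)
qed

end

section \<open>Characters and the eigenvalues of the graph\<close>

definition char17 :: "17 \<Rightarrow> complex" where
  "char17 k = cis (2 * pi * of_int (Rep_bit1 k) / 17)"

lemma cis_mod_17: "cis (2 * pi * of_int (n mod 17) / 17) = cis (2 * pi * of_int n / 17)"
proof -
  have "real_of_int n = of_int (n mod 17) + 17 * of_int (n div 17)"
    by (metis mod_mult_div_eq of_int_add of_int_mult of_int_numeral)
  then have split: "2 * pi * of_int n / 17 = 2 * pi * of_int (n mod 17) / 17 + 2 * pi * of_int (n div 17)"
    by (simp add: field_simps)
  have "cis (2 * pi * of_int (n div 17)) = 1"
    by (rule cis_multiple_2pi) simp
  then show ?thesis by (simp only: split cis_mult[symmetric] mult_1_right)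
qed

lemma char17_of_int: "char17 (of_int n) = cis (2 * pi * of_int n / 17)"
proof -
  have "Rep_bit1 (of_int n :: 17) = n mod 17"
    using bit1.Rep_Abs_mod[where ?'a = 8, of n] bit1.of_int_eq[where ?'a = 8, of n] by simp
  then show ?thesis by (simp add: char17_def cis_mod_17)
qed

lemma char17_0 [simp]: "char17 0 = 1"
  using char17_of_int[of 0] by simp

lemma char17_add: "char17 (a + b) = char17 a * char17 b"
proof -
  obtain m n where "a = of_int m" "b = of_int n" by (metis bit1_cases)
  then show ?thesis
    using char17_of_int[of "m + n"] by (simp add: char17_of_int cis_mult add_divide_distrib distrib_left)
qed

lemma char17_eq_1: assumes "char17 k = 1" shows "k = 0"
proof -
  obtain n where n: "k = of_int n" "0 \<le> n" "n < 17" by (cases k) auto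
  have "cos (2 * pi * of_int n / 17) = 1"
    using assms by (simp add: n(1) char17_of_int complex_eq_iff)
  then obtain m :: int where "2 * pi * of_int n / 17 = of_int m * 2 * pi"
    unfolding cos_one_2pi_int by blast
  then have "real_of_int n = of_int (17 * m)" by (simp add: field_simps)
  then have "n = 17 * m" by (simp only: of_int_eq_iff)
  then have "n = 0" using n by presburger
  then show ?thesis by (simp add: n)
qed

lemma sum_char17: "(\<Sum>a\<in>UNIV. char17 (a * k)) = (if k = 0 then 17 else 0)"
proof (cases "k = 0")
  case False
  have "(\<Sum>a\<in>UNIV. char17 (a * k)) = (\<Sum>a\<in>UNIV. char17 ((a + 1) * k))"
    by (rule sum.reindex_bij_betw[symmetric], rule o_bij[of "\<lambda>a. a - 1"]) auto
  also have "\<dots> = char17 k * (\<Sum>a\<in>UNIV. char17 (a * k))"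
    by (simp add: distrib_right char17_add sum_distrib_left mult.commute[of "char17 k"])
  finally have "(1 - char17 k) * (\<Sum>a\<in>UNIV. char17 (a * k)) = 0"
    by (simp add: left_diff_distrib)
  then show ?thesis using char17_eq_1[of k] False by auto
qed simp

text \<open>The eigenvalue of the adjacency matrix on the \<open>j\<close>-th character.\<close>

definition eigenvalue :: "17 \<Rightarrow> complex" where
  "eigenvalue j = (\<Sum>s\<in>QR. char17 (j * s))"

lemma eigenvalue_QR: assumes "j \<in> QR" shows "eigenvalue j = eigenvalue 1"
proof -
  obtain j' where j': "j' \<in> QR" "j' * j = 1" using QR_inverse[OF assms] by blast
  have "bij_betw ((*) j) QR QR"
    by (rule bij_betw_byWitness[of _ "(*) j'"])
      (use assms j' in \<open>auto intro: QR_mult simp: mult.commute[of j j'] simp flip: mult.assoc\<close>)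
  from sum.reindex_bij_betw[OF this, of char17] show ?thesis
    by (simp add: eigenvalue_def)
qed

text \<open>Multiplication by a nonsquare maps the nonzero squares onto the nonsquares, and the
  values of a nontrivial character at nonzero points add up to \<open>-1\<close>.\<close>

lemma eigenvalue_nonresidue: assumes "j \<noteq> 0" "j \<notin> QR" shows "eigenvalue j = - 1 - eigenvalue 1"
proof -
  have inj: "inj_on ((*) j) QR"
  proof -
    \<comment> \<open>3 is a nonsquare, so \<open>3 * j\<close> is a square, and squares have inverses.\<close>
    have "\<forall>j. j \<noteq> 0 \<longrightarrow> j \<notin> QR \<longrightarrow> 3 * j \<in> QR"
      unfolding all_17 QR_def by simp
    then obtain j' where "(j' * 3) * j = 1"
      using assms QR_inverse[of "3 * j"] by (auto simp: mult.assoc)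
    then obtain j' where "j' * j = 1" by blast
    then show ?thesis by (intro inj_on_inverseI[of _ "(*) j'"]) (simp flip: mult.assoc)
  qed
  have sub: "(*) j ` QR \<subseteq> UNIV - {0} - QR"
  proof (rule image_subsetI)
    fix s assume s: "s \<in> QR"
    then obtain s' where s': "s' \<in> QR" "s' * s = 1" using QR_inverse by blast
    then have j: "j = s' * (j * s)" by (metis mult.left_commute mult.right_neutral)
    have "j * s \<noteq> 0" using j assms by auto
    moreover have "j * s \<notin> QR" using j QR_mult[OF s'(1)] assms by metis
    ultimately show "j * s \<in> UNIV - {0} - QR" by simp
  qed
  have "card (UNIV - {0} - QR) = card QR"
    by (simp add: card_Diff_subset QR_def)
  then have img: "(*) j ` QR = UNIV - {0} - QR"
    using card_subset_eq[OF _ sub] card_image[OF inj] by simp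
  have "eigenvalue j = (\<Sum>a\<in>UNIV - {0} - QR. char17 a)"
    unfolding eigenvalue_def img[symmetric] by (simp add: sum.reindex[OF inj])
  also have "\<dots> = (\<Sum>a\<in>UNIV. char17 a) - char17 0 - (\<Sum>a\<in>QR. char17 a)"
    by (subst sum_diff, simp, simp add: QR_def) (simp add: sum_diff1)
  finally show ?thesis using sum_char17[of 1] by (simp add: eigenvalue_def)
qed

text \<open>The two nontrivial eigenvalues add up to \<open>-1\<close>, so they differ unless both are \<open>-1/2\<close>.  A sign
  estimate excludes this: half the real part is the sum of the cosines of 1, 2, 4 and 8 times
  \<open>2\<pi>/17\<close>, of which the first two exceed \<open>1/2\<close>, the third is positive and the last is at
  least \<open>-1\<close>.\<close>

lemma Re_eigenvalue_1: "Re (eigenvalue 1) > 0"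
proof -
  have c: "Re (char17 (numeral n)) = cos (2 * pi * numeral n / 17)" for n
    using char17_of_int[of "numeral n"] by simp
  have r: "cos (2 * pi * (17 - x) / 17) = cos (2 * pi * x / 17)" for x :: real
  proof -
    have "2 * pi * (17 - x) / 17 = 2 * pi - 2 * pi * x / 17" by (simp add: field_simps)
    then show ?thesis by (simp only: cos_2pi_minus)
  qed
  have sym: "cos (2 * pi * 16 / 17) = cos (2 * pi * 1 / 17)" "cos (2 * pi * 15 / 17) = cos (2 * pi * 2 / 17)"
    "cos (2 * pi * 13 / 17) = cos (2 * pi * 4 / 17)" "cos (2 * pi * 9 / 17) = cos (2 * pi * 8 / 17)"
    using r[of 1] r[of 2] r[of 4] r[of 8] by simp_all
  have half: "cos (2 * pi * x / 17) > 1 / 2" if "0 \<le> x" "x < 17 / 6" for x :: real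
    unfolding cos_60[symmetric] by (rule cos_monotone_0_pi) (use that in \<open>auto simp: field_simps\<close>)
  have "cos (2 * pi * 4 / 17) > 0"
    by (rule cos_gt_zero) (auto simp: field_simps)
  moreover have "cos (2 * pi * 8 / 17) \<ge> -1" by simp
  moreover have "cos (2 * pi * 1 / 17) > 1 / 2" "cos (2 * pi * 2 / 17) > 1 / 2"
    by (intro half; simp)+
  moreover have "Re (eigenvalue 1) = Re (char17 1) + Re (char17 2) + Re (char17 4) + Re (char17 8)
      + Re (char17 9) + Re (char17 13) + Re (char17 15) + Re (char17 16)"
    by (simp add: eigenvalue_def QR_def)
  moreover have "Re (char17 1) = cos (2 * pi * 1 / 17)" using char17_of_int[of 1] by simp
  ultimately show ?thesis
    unfolding c sym by linarith
qed

lemma eigenvalue_neq: assumes "i \<in> QR" "j \<noteq> 0" "j \<notin> QR" shows "eigenvalue i \<noteq> eigenvalue j"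
  using Re_eigenvalue_1 eigenvalue_QR[OF assms(1)] eigenvalue_nonresidue[OF assms(2,3)]
  by (auto simp: complex_eq_iff)

section \<open>Fourier transform of a magic matrix\<close>

lemma sum_swap_outer: "(\<Sum>k\<in>A. \<Sum>l\<in>B. \<Sum>m\<in>C. f k l m) = (\<Sum>m\<in>C. \<Sum>l\<in>B. \<Sum>k\<in>A. f k l m)"
proof -
  have "(\<Sum>k\<in>A. \<Sum>l\<in>B. \<Sum>m\<in>C. f k l m) = (\<Sum>k\<in>A. \<Sum>m\<in>C. \<Sum>l\<in>B. f k l m)"
    by (intro sum.cong refl sum.swap)
  also have "\<dots> = (\<Sum>m\<in>C. \<Sum>k\<in>A. \<Sum>l\<in>B. f k l m)" by (rule sum.swap)
  also have "\<dots> = (\<Sum>m\<in>C. \<Sum>l\<in>B. \<Sum>k\<in>A. f k l m)"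
    by (intro sum.cong refl sum.swap)
  finally show ?thesis .
qed

locale complex_algebra = vector_space scale
  for scale :: "complex \<Rightarrow> 'r::ring \<Rightarrow> 'r" +
  assumes mult_scale_left: "scale c x * y = scale c (x * y)"
    and mult_scale_right: "x * scale c y = scale c (x * y)"
begin

definition dft :: "(17 \<Rightarrow> 'r) \<Rightarrow> 17 \<Rightarrow> 'r" where
  "dft f j = scale (1 / 17) (\<Sum>k\<in>UNIV. scale (char17 (- (j * k))) (f k))"

definition idft :: "(17 \<Rightarrow> 'r) \<Rightarrow> 17 \<Rightarrow> 'r" where
  "idft f k = (\<Sum>j\<in>UNIV. scale (char17 (j * k)) (f j))"

lemma dft_mult: "(\<Sum>a\<in>UNIV. dft f a * dft g (s - a)) = dft (\<lambda>k. f k * g k) s"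
proof -
  have "dft f a * dft g (s - a) = (\<Sum>k\<in>UNIV. \<Sum>l\<in>UNIV.
      scale (1 / 17 * (1 / 17) * char17 (- (s * l)) * char17 (a * (l - k))) (f k * g l))" for a
    unfolding dft_def mult_scale_left mult_scale_right sum_distrib_left sum_distrib_right
    by (subst sum.swap) (simp add: scale_sum_right mult_scale_left mult_scale_right mult_ac algebra_simps flip: char17_add)
  then have "(\<Sum>a\<in>UNIV. dft f a * dft g (s - a)) = (\<Sum>a\<in>UNIV. \<Sum>k\<in>UNIV. \<Sum>l\<in>UNIV.
      scale (1 / 17 * (1 / 17) * char17 (- (s * l)) * char17 (a * (l - k))) (f k * g l))"
    by (simp only:)
  also have "\<dots> = (\<Sum>k\<in>UNIV. \<Sum>l\<in>UNIV. \<Sum>a\<in>UNIV.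
      scale (1 / 17 * (1 / 17) * char17 (- (s * l)) * char17 (a * (l - k))) (f k * g l))"
    by (subst sum.swap, rule sum.cong[OF refl], rule sum.swap)
  also have "\<dots> = (\<Sum>k\<in>UNIV. \<Sum>l\<in>UNIV.
      scale (1 / 17 * (1 / 17) * char17 (- (s * l)) * (\<Sum>a\<in>UNIV. char17 (a * (l - k)))) (f k * g l))"
    by (simp only: sum_distrib_left scale_sum_left)
  also have "\<dots> = (\<Sum>k\<in>UNIV. \<Sum>l\<in>UNIV. if l = k then scale (1 / 17 * char17 (- (s * k))) (f k * g k) else 0)"
    unfolding sum_char17 by (intro sum.cong refl) auto
  also have "\<dots> = dft (\<lambda>k. f k * g k) s"
    by (simp add: dft_def scale_sum_right)
  finally show ?thesis .
qed

lemma idft_dft: "idft (dft f) k = f k"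
proof -
  have "idft (dft f) k = (\<Sum>j\<in>UNIV. \<Sum>l\<in>UNIV. scale (1 / 17 * char17 (j * (k - l))) (f l))"
    by (simp add: idft_def dft_def scale_sum_right algebra_simps flip: char17_add)
  also have "\<dots> = (\<Sum>l\<in>UNIV. scale (1 / 17 * (\<Sum>j\<in>UNIV. char17 (j * (k - l)))) (f l))"
    by (subst sum.swap) (simp only: sum_distrib_left scale_sum_left)
  also have "\<dots> = (\<Sum>l\<in>UNIV. if l = k then f l else 0)"
    unfolding sum_char17 by (intro sum.cong refl) auto
  finally show ?thesis by simp
qed

lemma dft_idft: "dft (idft f) k = f k"
proof -
  have "dft (idft f) k = (\<Sum>j\<in>UNIV. \<Sum>l\<in>UNIV. scale (1 / 17 * char17 (j * (l - k))) (f l))"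
    by (simp add: idft_def dft_def scale_sum_right algebra_simps flip: char17_add)
  also have "\<dots> = (\<Sum>l\<in>UNIV. scale (1 / 17 * (\<Sum>j\<in>UNIV. char17 (j * (l - k)))) (f l))"
    by (subst sum.swap) (simp only: sum_distrib_left scale_sum_left)
  also have "\<dots> = (\<Sum>l\<in>UNIV. if l = k then f l else 0)"
    unfolding sum_char17 by (intro sum.cong refl) auto
  finally show ?thesis by simp
qed

lemma commute_dft:
  assumes "\<And>k. x * f k = f k * x"
  shows "x * dft f j = dft f j * x" "x * idft f j = idft f j * x"
  by (simp_all add: dft_def idft_def sum_distrib_left sum_distrib_right mult_scale_left mult_scale_right assms)

end

text \<open>
  The unit is represented by an arbitrary element \<open>e\<close>, the common value of the row and column sums,
  because the class of rings with 1 excludes the zero ring, and a ring given by generators and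
  relations is not known to be nonzero beforehand.
\<close>

locale magic_matrix = complex_algebra scale
  for scale :: "complex \<Rightarrow> 'r::ring \<Rightarrow> 'r" +
  fixes u :: "17 \<Rightarrow> 17 \<Rightarrow> 'r" and e :: 'r
  assumes idem: "u i j * u i j = u i j"
    and row_orth: "j \<noteq> k \<Longrightarrow> u i j * u i k = 0"
    and col_orth: "i \<noteq> k \<Longrightarrow> u i j * u k j = 0"
    and row_sum: "(\<Sum>j\<in>UNIV. u i j) = e"
    and col_sum: "(\<Sum>i\<in>UNIV. u i j) = e"
begin

lemma magic_matrix_transposed: "magic_matrix scale (\<lambda>i j. u j i) e"
  by unfold_locales (simp_all add: idem row_orth col_orth row_sum col_sum)

text \<open>The matrix of the coaction in the basis of characters: \<open>idft (u k) i\<close> is the coefficient at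
  the point \<open>k\<close> of the image of the \<open>i\<close>-th character.\<close>

definition fourier :: "17 \<Rightarrow> 17 \<Rightarrow> 'r" where
  "fourier i j = dft (\<lambda>k. idft (u k) i) j"

text \<open>Entries in a row are orthogonal idempotents, so the linear map taking the \<open>l\<close>-th point mass
  to \<open>u k l\<close> is multiplicative; apply it to characters.\<close>

lemma idft_row_mult: "idft (u k) i * idft (u k) j = idft (u k) (i + j)"
proof -
  have "idft (u k) i * idft (u k) j
      = (\<Sum>l\<in>UNIV. \<Sum>m\<in>UNIV. if m = l then scale (char17 (l * (i + j))) (u k l) else 0)"
    unfolding idft_def sum_product
    by (intro sum.cong refl) (simp add: mult_scale_left mult_scale_right idem row_orth distrib_left char17_add)
  then show ?thesis by (simp add: idft_def)
qed

lemma fourier_row: "(\<Sum>a\<in>UNIV. fourier i a * fourier j (s - a)) = fourier (i + j) s"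
  unfolding fourier_def by (simp add: dft_mult idft_row_mult)

text \<open>Transposing \<open>u\<close> transposes its Fourier transform up to signs, so each relation for the rows
  yields one for the columns.\<close>

lemma fourier_transposed: "magic_matrix.fourier scale (\<lambda>i j. u j i) (- j) (- i) = fourier i j"
proof -
  interpret t: magic_matrix scale "\<lambda>i j. u j i" e by (rule magic_matrix_transposed)
  have "t.fourier (- j) (- i) = (\<Sum>k\<in>UNIV. \<Sum>l\<in>UNIV. scale (1 / 17 * char17 (i * k - j * l)) (u l k))"
    by (simp add: t.fourier_def dft_def idft_def scale_sum_right algebra_simps flip: char17_add)
  also have "\<dots> = fourier i j"
    by (subst sum.swap) (simp add: fourier_def dft_def idft_def scale_sum_right algebra_simps flip: char17_add)
  finally show ?thesis .
qed

lemma fourier_col: "(\<Sum>i\<in>UNIV. fourier i a * fourier (t - i) b) = fourier t (a + b)"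
proof -
  interpret t: magic_matrix scale "\<lambda>i j. u j i" e by (rule magic_matrix_transposed)
  have "(\<Sum>i\<in>UNIV. fourier i a * fourier (t - i) b)
      = (\<Sum>i\<in>UNIV. t.fourier (- a) (- i) * t.fourier (- b) (- t - (- i)))"
    by (simp flip: fourier_transposed)
  also have "\<dots> = (\<Sum>i\<in>UNIV. t.fourier (- a) i * t.fourier (- b) (- t - i))"
    by (rule sum.reindex_bij_betw[of uminus]) (rule o_bij[of uminus]; auto)
  also have "\<dots> = fourier t (a + b)"
    by (simp add: t.fourier_row flip: fourier_transposed)
  finally show ?thesis .
qed

lemma fourier_0_right: "i \<noteq> 0 \<Longrightarrow> fourier i 0 = 0"
proof -
  assume i: "i \<noteq> 0"
  have "fourier i 0 = scale (1 / 17) (\<Sum>l\<in>UNIV. scale (char17 (l * i)) (\<Sum>k\<in>UNIV. u k l))"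
    by (simp add: fourier_def dft_def idft_def scale_sum_right) (rule sum.swap)
  also have "\<dots> = 0"
    using sum_char17[of i] i by (simp add: col_sum flip: scale_sum_left)
  finally show ?thesis .
qed

lemma fourier_0_left: "j \<noteq> 0 \<Longrightarrow> fourier 0 j = 0"
  using magic_matrix.fourier_0_right[OF magic_matrix_transposed, of "- j"] fourier_transposed[of j 0] by simp

lemma commute_from_fourier:
  assumes "\<And>i j i' j'. fourier i j * fourier i' j' = fourier i' j' * fourier i j"
  shows "u k l * u k' l' = u k' l' * u k l"
proof -
  have *: "x * u k l = u k l * x" if "\<And>i j. x * fourier i j = fourier i j * x" for x k l
  proof -
    have "x * idft (u k) i = idft (u k) i * x" for i
      using commute_dft(2)[of x "fourier i" k] that by (simp add: fourier_def[abs_def] idft_dft)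
    then show ?thesis
      using commute_dft(1)[of x "idft (u k)" l] by (simp add: dft_idft)
  qed
  have "u k l * fourier i j = fourier i j * u k l" for i j k l
    using *[of "fourier i j" k l] assms by simp
  then show ?thesis by (rule *)
qed

end

locale paley_magic_matrix = magic_matrix scale u e
  for scale :: "complex \<Rightarrow> 'r::ring \<Rightarrow> 'r" and u :: "17 \<Rightarrow> 17 \<Rightarrow> 'r" and e :: 'r +
  assumes adjacency_commute: "(\<Sum>k\<in>UNIV. scale (adjacency_matrix C17_2_4_8 i k) (u k j)) =
      (\<Sum>k\<in>UNIV. scale (adjacency_matrix C17_2_4_8 k j) (u i k))"
begin

lemma adjacency_QR: "adjacency_matrix C17_2_4_8 i j = (if i - j \<in> QR then 1 else 0)"
proof -
  have "QR = {1, -1, 2, -2, 4, -4, 8, -8}"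
    by (simp add: QR_def reduce_17 insert_commute)
  then show ?thesis by (simp add: adjacency_matrix_def C17_2_4_8_def)
qed

lemma uminus_QR: "- a \<in> QR \<longleftrightarrow> a \<in> QR"
proof -
  have "- 1 \<in> QR" by (simp add: QR_def)
  then show ?thesis using QR_mult[of "- 1" a] QR_mult[of "- 1" "- a"] by auto
qed

lemma adjacency_sym: "adjacency_matrix C17_2_4_8 i j = adjacency_matrix C17_2_4_8 j i"
  using uminus_QR[of "i - j"] by (simp add: adjacency_QR)

text \<open>Characters are eigenvectors of the adjacency matrix of a Cayley graph.\<close>

lemma char_adjacency: "(\<Sum>k\<in>UNIV. char17 (j * k) * adjacency_matrix C17_2_4_8 k m) = char17 (j * m) * eigenvalue j"
proof -
  have "(\<Sum>k\<in>UNIV. char17 (j * k) * adjacency_matrix C17_2_4_8 k m)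
      = (\<Sum>s\<in>UNIV. char17 (j * (m + s)) * adjacency_matrix C17_2_4_8 (m + s) m)"
    by (rule sum.reindex_bij_betw[symmetric], rule o_bij[of "\<lambda>k. k - m"]) auto
  also have "\<dots> = (\<Sum>s\<in>UNIV. if s \<in> QR then char17 (j * m) * char17 (j * s) else 0)"
    by (intro sum.cong refl) (simp add: adjacency_QR distrib_left char17_add)
  also have "\<dots> = char17 (j * m) * eigenvalue j"
    by (simp add: eigenvalue_def sum_distrib_left flip: sum.inter_restrict)
  finally show ?thesis .
qed

text \<open>
  Multiplying \<open>d u = u d\<close> by characters on both sides multiplies the Fourier coefficient at \<open>(i, j)\<close> by
  the eigenvalue at \<open>j\<close> on one side and by that at \<open>i\<close> on the other.  If one index is a nonzero square
  and the other a nonsquare, these differ.  The case of an index 0 follows from the row and column sums.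
\<close>

lemma fourier_support: assumes "(i \<in> QR) \<noteq> (j \<in> QR)" shows "fourier i j = 0"
proof (cases "i = 0 \<or> j = 0")
  case True
  then show ?thesis using assms fourier_0_left fourier_0_right by (auto simp: QR_def)
next
  case False
  let ?d = "adjacency_matrix C17_2_4_8"
  have "scale (eigenvalue (- j)) (fourier i j) = (\<Sum>k\<in>UNIV. \<Sum>l\<in>UNIV.
      scale (1 / 17 * char17 (l * i) * (char17 (- j * k) * eigenvalue (- j))) (u k l))"
    by (simp add: fourier_def dft_def idft_def scale_sum_right mult_ac)
  also have "\<dots> = (\<Sum>k\<in>UNIV. \<Sum>l\<in>UNIV. \<Sum>m\<in>UNIV.
      scale (1 / 17 * char17 (l * i) * char17 (- j * m) * ?d m k) (u k l))"
    unfolding char_adjacency[symmetric] sum_distrib_left scale_sum_left by (simp only: mult.assoc)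
  also have "\<dots> = (\<Sum>m\<in>UNIV. \<Sum>l\<in>UNIV. \<Sum>k\<in>UNIV.
      scale (1 / 17 * char17 (l * i) * char17 (- j * m) * ?d m k) (u k l))"
    by (rule sum_swap_outer)
  also have "\<dots> = (\<Sum>m\<in>UNIV. \<Sum>l\<in>UNIV.
      scale (1 / 17 * char17 (l * i) * char17 (- j * m)) (\<Sum>k\<in>UNIV. scale (?d m k) (u k l)))"
    by (simp only: scale_sum_right scale_scale)
  also have "\<dots> = (\<Sum>m\<in>UNIV. \<Sum>l\<in>UNIV.
      scale (1 / 17 * char17 (l * i) * char17 (- j * m)) (\<Sum>k\<in>UNIV. scale (?d l k) (u m k)))"
    by (simp only: adjacency_commute) (simp only: adjacency_sym)
  also have "\<dots> = (\<Sum>m\<in>UNIV. \<Sum>k\<in>UNIV. \<Sum>l\<in>UNIV.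
      scale (1 / 17 * char17 (- j * m) * (char17 (i * l) * ?d l k)) (u m k))"
    by (rule sum.cong[OF refl], subst sum.swap) (simp add: scale_sum_right mult_ac)
  also have "\<dots> = (\<Sum>m\<in>UNIV. \<Sum>k\<in>UNIV.
      scale (1 / 17 * char17 (- j * m) * (char17 (i * k) * eigenvalue i)) (u m k))"
    by (simp only: char_adjacency flip: sum_distrib_left scale_sum_left)
  also have "\<dots> = scale (eigenvalue i) (fourier i j)"
    by (simp add: fourier_def dft_def idft_def scale_sum_right mult_ac)
  finally have "scale (eigenvalue (- j)) (fourier i j) = scale (eigenvalue i) (fourier i j)" .
  moreover have "eigenvalue (- j) \<noteq> eigenvalue i"
    using assms False eigenvalue_neq[of "- j" i] eigenvalue_neq[of i "- j"] uminus_QR[of j] by auto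
  ultimately show ?thesis by simp
qed

sublocale paley_coaction fourier
  by unfold_locales (rule fourier_support fourier_row fourier_col; assumption?)+

theorem entries_commute: "u k l * u k' l' = u k' l' * u k l"
  by (rule commute_from_fourier) (rule commute)

end

section \<open>Reduction to noncommutative polynomials\<close>

abbreviation magic_seminorm :: "('v::finite \<times> 'v) free_star_algebra \<Rightarrow> real" where
  "magic_seminorm \<equiv> universal_seminorm magic_relations"

text \<open>The image of a noncommutative polynomial in the quantum permutation algebra.\<close>

definition qperm_poly :: "('v::finite \<times> 'v) free_star_algebra \<Rightarrow> 'v qperm_elem" where
  "qperm_poly a = seq_class magic_seminorm (\<lambda>_. a)"

interpretation magic: cstar_seminorm "magic_seminorm :: ('v::finite \<times> 'v) free_star_algebra \<Rightarrow> real"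
  by (rule cstar_seminorm_magic)

lemma qperm_completion: "quantum_perm_algebra = completion magic_seminorm"
  by (simp add: quantum_perm_algebra_def universal_cstar_algebra_def)

lemma ring_qperm: "ring quantum_perm_algebra"
  unfolding qperm_completion by (rule magic.ring_completion)

lemma qperm_poly_closed [simp]: "qperm_poly a \<in> carrier quantum_perm_algebra"
  by (simp add: qperm_poly_def qperm_completion magic.seq_classI)

lemma qperm_poly_ops:
  "qperm_poly (a + b) = qperm_poly a \<oplus>\<^bsub>quantum_perm_algebra\<^esub> qperm_poly b"
  "qperm_poly (a * b) = qperm_poly a \<otimes>\<^bsub>quantum_perm_algebra\<^esub> qperm_poly b"
  "qperm_poly (a - b) = qperm_poly a \<ominus>\<^bsub>quantum_perm_algebra\<^esub> qperm_poly b"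
  "qperm_poly (fscale c a) = c \<odot>\<^bsub>quantum_perm_algebra\<^esub> qperm_poly a"
  "qperm_poly 0 = \<zero>\<^bsub>quantum_perm_algebra\<^esub>"
  by (simp_all add: qperm_poly_def qperm_completion magic.completion_ops magic.completion_minus)

lemma qperm_poly_sum:
  "finite S \<Longrightarrow> qperm_poly (\<Sum>i\<in>S. f i) = (\<Oplus>\<^bsub>quantum_perm_algebra\<^esub>i\<in>S. qperm_poly (f i))"
proof (induction S rule: finite_induct)
  interpret ring quantum_perm_algebra by (rule ring_qperm)
  case empty
  show ?case by (simp add: qperm_poly_ops)
next
  interpret ring quantum_perm_algebra by (rule ring_qperm)
  case (insert x S)
  then show ?case by (simp add: qperm_poly_ops)
qed

lemma qperm_gen_eq: "qperm_gen i j = qperm_poly (fgen (i, j))"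
  by (simp add: qperm_gen_def universal_gen_def qperm_poly_def)

lemma qperm_poly_relation: "r \<in> magic_relations \<Longrightarrow> qperm_poly r = \<zero>\<^bsub>quantum_perm_algebra\<^esub>"
  using universal_seminorm_relation[OF magic_admissible, of r]
  by (simp add: qperm_poly_def qperm_completion magic.completion_zero magic.seq_class_eq_iff)

lemma qperm_poly_dense:
  assumes "s \<in> Cauchy_seqs magic_seminorm"
  shows "cconverges quantum_perm_algebra (\<lambda>n. qperm_poly (s n)) (seq_class magic_seminorm s)"
  unfolding cconverges_def qperm_completion
proof (rule LIMSEQ_I)
  let ?N = "cnorm (completion magic_seminorm)"
  fix e :: real assume e: "e > 0"
  then have "e / 2 > 0" by simp
  then obtain K where K: "\<And>m n. m \<ge> K \<Longrightarrow> n \<ge> K \<Longrightarrow> magic_seminorm (s m - s n) < e / 2"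
    using assms unfolding Cauchy_seqs_def by blast
  have "norm (?N (qperm_poly (s k) \<ominus>\<^bsub>completion magic_seminorm\<^esub> seq_class magic_seminorm s) - 0) < e"
    if "k \<ge> K" for k
  proof -
    have l: "(\<lambda>n. magic_seminorm (s k - s n)) \<longlonglongrightarrow> ?N (seq_class magic_seminorm (\<lambda>n. s k - s n))"
      by (intro magic.completion_norm_LIMSEQ magic.Cauchy_diff assms) simp
    have "?N (seq_class magic_seminorm (\<lambda>n. s k - s n)) \<le> e / 2"
      using K that by (intro LIMSEQ_le_const2[OF l]) (auto intro!: exI[of _ K] less_imp_le)
    moreover have "?N (seq_class magic_seminorm (\<lambda>n. s k - s n)) \<ge> 0"
      by (intro LIMSEQ_le_const[OF l]) (auto simp: magic.nonneg)
    ultimately show ?thesis using e assms by (simp add: qperm_poly_def magic.completion_minus)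
  qed
  then show "\<exists>K. \<forall>k\<ge>K. norm (?N (qperm_poly (s k) \<ominus>\<^bsub>completion magic_seminorm\<^esub> seq_class magic_seminorm s) - 0) < e"
    by blast
qed

lemma closed_ideal_gen_closed_ideal:
  assumes "ring A" "S \<subseteq> carrier A"
  shows "closed_ideal A (gen_closed_ideal A S)" "S \<subseteq> gen_closed_ideal A S"
proof -
  interpret ring A by fact
  have "closed_ideal A (carrier A)"
    by (auto simp: closed_ideal_def oneideal)
  then have "ideal (gen_closed_ideal A S) A"
    unfolding gen_closed_ideal_def using assms(2)
    by (intro i_Intersect) (auto simp: closed_ideal_def)
  then show "closed_ideal A (gen_closed_ideal A S)"
    unfolding closed_ideal_def gen_closed_ideal_def by blast
  show "S \<subseteq> gen_closed_ideal A S"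
    unfolding gen_closed_ideal_def by blast
qed

definition graph_ideal :: "('v::finite \<Rightarrow> 'v \<Rightarrow> bool) \<Rightarrow> 'v qperm_elem set" where
  "graph_ideal X = gen_closed_ideal quantum_perm_algebra (commutation_relations (adjacency_matrix X))"

text \<open>The polynomials that become zero in the quantum automorphism algebra of the graph.\<close>

definition vanishing :: "('v::finite \<Rightarrow> 'v \<Rightarrow> bool) \<Rightarrow> ('v \<times> 'v) free_star_algebra \<Rightarrow> bool" where
  "vanishing X a \<longleftrightarrow> qperm_poly a \<in> graph_ideal X"

lemma commutation_relations_poly:
  "commutation_relations d = {qperm_poly ((\<Sum>k\<in>UNIV. fscale (d i k) (fgen (k, j))) -
     (\<Sum>k\<in>UNIV. fscale (d k j) (fgen (i, k)))) | i j. True}"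
  by (simp add: commutation_relations_def Let_def qperm_poly_ops qperm_poly_sum qperm_gen_eq)

lemma graph_ideal:
  "closed_ideal quantum_perm_algebra (graph_ideal X)"
  "commutation_relations (adjacency_matrix X) \<subseteq> graph_ideal X"
proof -
  have "commutation_relations (adjacency_matrix X) \<subseteq> carrier quantum_perm_algebra"
    by (auto simp: commutation_relations_poly)
  from closed_ideal_gen_closed_ideal[OF ring_qperm this]
  show "closed_ideal quantum_perm_algebra (graph_ideal X)"
    "commutation_relations (adjacency_matrix X) \<subseteq> graph_ideal X"
    by (simp_all add: graph_ideal_def)
qed

lemma ideal_graph_ideal: "ideal (graph_ideal X) quantum_perm_algebra"
  using graph_ideal(1)[of X] by (simp add: closed_ideal_def)

lemma graph_ideal_limit:
  assumes "\<And>n. s n \<in> graph_ideal X" "x \<in> carrier quantum_perm_algebra"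
    and "cconverges quantum_perm_algebra s x"
  shows "x \<in> graph_ideal X"
  using graph_ideal(1)[of X] assms unfolding closed_ideal_def by blast

lemma vanishing_add: "vanishing X a \<Longrightarrow> vanishing X b \<Longrightarrow> vanishing X (a + b)"
  using additive_subgroup.a_closed[OF ideal.axioms(1)[OF ideal_graph_ideal[of X]]]
  by (simp add: vanishing_def qperm_poly_ops)

lemma vanishing_mult:
  assumes "vanishing X a"
  shows "vanishing X (b * a)" "vanishing X (a * b)"
  using assms ideal.I_l_closed[OF ideal_graph_ideal[of X]] ideal.I_r_closed[OF ideal_graph_ideal[of X]]
  by (simp_all add: vanishing_def qperm_poly_ops)

lemma vanishing_uminus: "vanishing X a \<Longrightarrow> vanishing X (- a)"
  using vanishing_mult(1)[of X a "- 1"] by simp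

lemma vanishing_zero: "vanishing X 0"
  using additive_subgroup.zero_closed[OF ideal.axioms(1)[OF ideal_graph_ideal[of X]]]
  by (simp add: vanishing_def qperm_poly_ops)

lemma vanishing_magic: "r \<in> magic_relations \<Longrightarrow> vanishing X r"
  using additive_subgroup.zero_closed[OF ideal.axioms(1)[OF ideal_graph_ideal[of X]]]
  by (simp add: vanishing_def qperm_poly_relation)

lemma vanishing_adjacency:
  "vanishing X ((\<Sum>k\<in>UNIV. fscale (adjacency_matrix X i k) (fgen (k, j))) -
     (\<Sum>k\<in>UNIV. fscale (adjacency_matrix X k j) (fgen (i, k))))"
  using graph_ideal(2)[of X] unfolding vanishing_def commutation_relations_poly by blast

text \<open>
  Arbitrary elements \<open>x, y\<close> are limits of polynomials \<open>s\<^sub>n, t\<^sub>n\<close>.  The commutators of \<open>s\<^sub>n\<close> and \<open>t\<^sub>n\<close> lie in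
  the ideal and converge to the commutator of \<open>x\<close> and \<open>y\<close>, which lies in the ideal because the ideal
  is closed.
\<close>

lemma no_quantum_symmetry_criterion:
  assumes "\<And>a b. vanishing X (a * b - b * a)"
  shows "no_quantum_symmetry X"
proof -
  let ?A = "quantum_perm_algebra :: 'a qperm_elem cstar_algebra"
  interpret ideal "graph_ideal X" ?A by (rule ideal_graph_ideal)
  have comm: "x \<otimes>\<^bsub>?A\<^esub> y \<ominus>\<^bsub>?A\<^esub> y \<otimes>\<^bsub>?A\<^esub> x \<in> graph_ideal X"
    if "x \<in> carrier ?A" "y \<in> carrier ?A" for x y
  proof -
    obtain s t where s: "s \<in> Cauchy_seqs magic_seminorm" "x = seq_class magic_seminorm s"
      and t: "t \<in> Cauchy_seqs magic_seminorm" "y = seq_class magic_seminorm t"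
      using \<open>x \<in> carrier ?A\<close> \<open>y \<in> carrier ?A\<close> unfolding qperm_completion by (meson magic.carrierE)
    let ?c = "\<lambda>n. s n * t n - t n * s n"
    have "?c \<in> Cauchy_seqs magic_seminorm"
      by (intro magic.Cauchy_diff magic.Cauchy_mult s t)
    from qperm_poly_dense[OF this]
    have lim: "cconverges ?A (\<lambda>n. qperm_poly (?c n)) (x \<otimes>\<^bsub>?A\<^esub> y \<ominus>\<^bsub>?A\<^esub> y \<otimes>\<^bsub>?A\<^esub> x)"
      using s t unfolding qperm_completion
      by (simp add: magic.completion_mult magic.completion_minus magic.Cauchy_mult)
    have "qperm_poly (?c n) \<in> graph_ideal X" for n
      using assms by (simp add: vanishing_def)
    then show ?thesis
      by (rule graph_ideal_limit[OF _ _ lim]) (use that in simp)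
  qed
  have "P \<otimes>\<^bsub>?A Quot graph_ideal X\<^esub> Q = Q \<otimes>\<^bsub>?A Quot graph_ideal X\<^esub> P"
    if P: "P \<in> carrier (?A Quot graph_ideal X)" and Q: "Q \<in> carrier (?A Quot graph_ideal X)" for P Q
  proof -
    obtain x y where x: "x \<in> carrier ?A" "P = graph_ideal X +>\<^bsub>?A\<^esub> x"
      and y: "y \<in> carrier ?A" "Q = graph_ideal X +>\<^bsub>?A\<^esub> y"
      using P Q unfolding FactRing_def A_RCOSETS_def' by auto
    have "graph_ideal X +>\<^bsub>?A\<^esub> (x \<otimes>\<^bsub>?A\<^esub> y) = graph_ideal X +>\<^bsub>?A\<^esub> (y \<otimes>\<^bsub>?A\<^esub> x)"
      using comm[OF x(1) y(1)] x y quotient_eq_iff_same_a_r_cos[OF ideal_graph_ideal] by simp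
    then show ?thesis
      using x y by (simp add: FactRing_def rcoset_mult_add)
  qed
  then show ?thesis
    unfolding no_quantum_symmetry_def commutative_algebra_def quantum_automorphism_algebra_def
      cstar_quotient_def graph_ideal_def[symmetric] by simp
qed

section \<open>The coordinate ring\<close>

definition coordinate_rel :: "(17 \<times> 17) free_star_algebra \<Rightarrow> (17 \<times> 17) free_star_algebra \<Rightarrow> bool" where
  "coordinate_rel a b \<longleftrightarrow> vanishing C17_2_4_8 (a - b)"

lemma equivp_coordinate_rel: "equivp coordinate_rel"
proof (rule equivpI)
  show "reflp coordinate_rel"
    by (simp add: reflp_def coordinate_rel_def vanishing_zero)
  show "symp coordinate_rel"
    using vanishing_uminus by (fastforce simp: symp_def coordinate_rel_def)
  show "transp coordinate_rel"
    using vanishing_add by (fastforce simp: transp_def coordinate_rel_def)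
qed

text \<open>
  The subalgebra of the quantum automorphism algebra generated by the \<open>u\<^sub>i\<^sub>j\<close>, as a type: polynomials
  modulo those that vanish.  On a type, the Fourier argument is ordinary ring arithmetic, free of
  carrier sets.
\<close>

quotient_type coordinate = "(17 \<times> 17) free_star_algebra" / coordinate_rel
  by (rule equivp_coordinate_rel)

lemma coordinate_rel_mult:
  assumes "coordinate_rel a b" "coordinate_rel c d"
  shows "coordinate_rel (a * c) (b * d)"
  using vanishing_add[OF vanishing_mult(1) vanishing_mult(2), of _ "c - d" "a - b" a d] assms
  by (simp add: coordinate_rel_def algebra_simps)

lemma coordinate_rel_add:
  assumes "coordinate_rel a b" "coordinate_rel c d"
  shows "coordinate_rel (a + c) (b + d)"
  using vanishing_add[of _ "a - b" "c - d"] assms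
  by (simp add: coordinate_rel_def algebra_simps)

lemma coordinate_rel_uminus: "coordinate_rel a b \<Longrightarrow> coordinate_rel (- a) (- b)"
  using vanishing_uminus[of _ "a - b"] by (simp add: coordinate_rel_def algebra_simps)

instantiation coordinate :: ring
begin

lift_definition zero_coordinate :: coordinate is 0 .
lift_definition plus_coordinate :: "coordinate \<Rightarrow> coordinate \<Rightarrow> coordinate" is "(+)"
  by (rule coordinate_rel_add)
lift_definition uminus_coordinate :: "coordinate \<Rightarrow> coordinate" is uminus
  by (rule coordinate_rel_uminus)
lift_definition minus_coordinate :: "coordinate \<Rightarrow> coordinate \<Rightarrow> coordinate" is "(-)"
  using coordinate_rel_add coordinate_rel_uminus by fastforce
lift_definition times_coordinate :: "coordinate \<Rightarrow> coordinate \<Rightarrow> coordinate" is "(*)"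
  by (rule coordinate_rel_mult)

instance
  by standard
    (transfer; simp add: algebra_simps equivp_reflp[OF equivp_coordinate_rel])+

end

lift_definition cscale :: "complex \<Rightarrow> coordinate \<Rightarrow> coordinate" is fscale
  using coordinate_rel_mult[OF equivp_reflp[OF equivp_coordinate_rel]] by (simp add: fscale_def)

lift_definition coord :: "17 \<Rightarrow> 17 \<Rightarrow> coordinate" is "\<lambda>i j. fgen (i, j)" .

lift_definition coord_unit :: coordinate is 1 .

lemma abs_coordinate_sum: "finite S \<Longrightarrow> abs_coordinate (\<Sum>i\<in>S. f i) = (\<Sum>i\<in>S. abs_coordinate (f i))"
  by (induction S rule: finite_induct) (simp_all flip: zero_coordinate.abs_eq plus_coordinate.abs_eq)

lemma abs_coordinate_eq: "vanishing C17_2_4_8 (a - b) \<Longrightarrow> abs_coordinate a = abs_coordinate b"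
  by (simp add: coordinate.abs_eq_iff coordinate_rel_def)

interpretation coord: paley_magic_matrix cscale coord coord_unit
proof
  fix a b and x y :: coordinate
  show "cscale a (x + y) = cscale a x + cscale a y"
    by transfer (simp add: fscale_add_right equivp_reflp[OF equivp_coordinate_rel])
  show "cscale (a + b) x = cscale a x + cscale b x"
    by transfer (simp add: fscale_add_left equivp_reflp[OF equivp_coordinate_rel])
  show "cscale a (cscale b x) = cscale (a * b) x"
    by transfer (simp add: fscale_fscale equivp_reflp[OF equivp_coordinate_rel])
  show "cscale 1 x = x"
    by transfer (simp add: equivp_reflp[OF equivp_coordinate_rel])
  show "cscale a x * y = cscale a (x * y)"
    by transfer (simp add: fscale_mult_left equivp_reflp[OF equivp_coordinate_rel])
  show "x * cscale a y = cscale a (x * y)"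
    by transfer (simp add: fscale_mult_right equivp_reflp[OF equivp_coordinate_rel])
next
  fix i j k :: 17
  have *: "abs_coordinate a = abs_coordinate b" if "a - b \<in> magic_relations" for a b
    by (rule abs_coordinate_eq[OF vanishing_magic[OF that]])
  show "coord i j * coord i j = coord i j"
    unfolding coord.abs_eq times_coordinate.abs_eq by (rule *) (auto simp: magic_relations_def)
  show "coord i j * coord i k = 0" if "j \<noteq> k"
    unfolding coord.abs_eq times_coordinate.abs_eq zero_coordinate.abs_eq
    by (rule *) (use that in \<open>auto simp: magic_relations_def\<close>)
  show "coord i j * coord k j = 0" if "i \<noteq> k"
    unfolding coord.abs_eq times_coordinate.abs_eq zero_coordinate.abs_eq
    by (rule *) (use that in \<open>auto simp: magic_relations_def\<close>)
  show "(\<Sum>j\<in>UNIV. coord i j) = coord_unit"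
    unfolding coord.abs_eq coord_unit.abs_eq abs_coordinate_sum[OF finite, symmetric]
    by (rule *) (auto simp: magic_relations_def)
  show "(\<Sum>i\<in>UNIV. coord i j) = coord_unit"
    unfolding coord.abs_eq coord_unit.abs_eq abs_coordinate_sum[OF finite, symmetric]
    by (rule *) (auto simp: magic_relations_def)
  show "(\<Sum>k\<in>UNIV. cscale (adjacency_matrix C17_2_4_8 i k) (coord k j)) =
      (\<Sum>k\<in>UNIV. cscale (adjacency_matrix C17_2_4_8 k j) (coord i k))"
    unfolding coord.abs_eq cscale.abs_eq abs_coordinate_sum[OF finite, symmetric]
    by (rule abs_coordinate_eq[OF vanishing_adjacency])
qed

text \<open>The adjoint letters bring nothing new, because the \<open>u\<^sub>i\<^sub>j\<close> are self-adjoint.\<close>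

lemma coord_star: "abs_coordinate (Poly_Mapping.single (Word [((i, j), s)]) 1) = coord i j"
proof (cases s)
  case True
  have "fstar (fgen (i, j)) = Poly_Mapping.single (Word [((i, j), True)]) 1"
    by (simp add: fgen_def fstar_single word_star_def)
  moreover have "fstar (fgen (i, j)) - fgen (i, j) \<in> magic_relations"
    by (auto simp: magic_relations_def)
  ultimately show ?thesis
    using True abs_coordinate_eq[OF vanishing_magic] by (simp add: coord.abs_eq)
qed (simp add: coord.abs_eq fgen_def)

lemma coord_generate:
  assumes "\<And>i j. x * coord i j = coord i j * x"
  shows "x * abs_coordinate a = abs_coordinate a * x"
proof (induction a rule: free_star_algebra_induct)
  case zero
  show ?case by (simp flip: zero_coordinate.abs_eq)
next
  case (add_single a w c)
  have word: "x * abs_coordinate (Poly_Mapping.single (Word v) 1) = abs_coordinate (Poly_Mapping.single (Word v) 1) * x" for v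
  proof (induction v)
    case Nil
    have "Poly_Mapping.single (Word []) 1 = (1 :: (17 \<times> 17) free_star_algebra)"
      by (simp flip: zero_star_word_def)
    moreover have "x * coord_unit = x" "coord_unit * x = x"
      by (transfer; simp add: equivp_reflp[OF equivp_coordinate_rel])+
    ultimately show ?case by (simp flip: coord_unit.abs_eq)
  next
    case (Cons l v)
    obtain i j s where l: "l = ((i, j), s)" by (metis surj_pair)
    have "Poly_Mapping.single (Word (l # v)) 1
        = Poly_Mapping.single (Word [l]) (1::complex) * Poly_Mapping.single (Word v) 1"
      by (simp add: mult_single plus_star_word_def)
    then have "abs_coordinate (Poly_Mapping.single (Word (l # v)) 1)
        = coord i j * abs_coordinate (Poly_Mapping.single (Word v) 1)"
      by (simp only: l coord_star times_coordinate.abs_eq[symmetric])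
    then show ?case
      by (simp only: mult.assoc[symmetric] assms) (simp only: mult.assoc Cons)
  qed
  have "Poly_Mapping.single w c = fscale c (Poly_Mapping.single (Word (letters w)) 1)"
    by (simp add: fscale_def mult_single)
  then have "abs_coordinate (Poly_Mapping.single w c) = cscale c (abs_coordinate (Poly_Mapping.single (Word (letters w)) 1))"
    by (simp only: cscale.abs_eq)
  then have "x * abs_coordinate (Poly_Mapping.single w c) = abs_coordinate (Poly_Mapping.single w c) * x"
    by (simp only: coord.mult_scale_left coord.mult_scale_right word)
  with add_single show ?case
    by (simp add: distrib_left distrib_right flip: plus_coordinate.abs_eq)
qed

text \<open>By \<open>entries_commute\<close> the generators of the coordinate ring commute; two applications of
  \<open>coord_generate\<close> pass to arbitrary polynomials, one for each factor.\<close>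

theorem theorem8p3:
  shows "no_quantum_symmetry C17_2_4_8"
proof (rule no_quantum_symmetry_criterion)
  fix a b
  have "abs_coordinate a * coord i j = coord i j * abs_coordinate a" for i j
    by (rule coord_generate[symmetric]) (rule coord.entries_commute)
  then have "abs_coordinate a * abs_coordinate b = abs_coordinate b * abs_coordinate a"
    by (rule coord_generate)
  then show "vanishing C17_2_4_8 (a * b - b * a)"
    by (simp add: times_coordinate.abs_eq coordinate.abs_eq_iff coordinate_rel_def)
qed

end
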